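(* Let $d\ge 1$. For every finite set $X\subseteq\mathbb{T}_{\pm}^d$, its TC-convex hull $\mathrm{conv}_{TC}(X)$ is equal to the intersection of the closed tropical halfspaces that contain $X$.
   Context: Signed tropical numbers. Let $\mathbb{O}=-\infty$ be the tropical zero. $\mathbb{T}_{>\mathbb{O}}=\mathbb{R}$ (positive numbers), $\mathbb{T}_{<\mathbb{O}}=\{\ominus r: r\in\mathbb{R}\}$ (negative numbers), $\mathbb{T}_{\pm}=\mathbb{T}_{>\mathbb{O}}\cup\mathbb{T}_{<\mathbb{O}}\cup\{\mathbb{O}\}$, balanced numbers $\mathbb{T}_{\bullet}=\{\bullet r: r\in\mathbb{R}\}\cup\{\mathbb{O}\}$, symmetrized semiring $\mathbb{S}=\mathbb{T}_{\pm}\cup\mathbb{T}_{\bullet}$. The norm is $|r|=|\ominus r|=|\bullet r|=r$ and $|\mathbb{O}|=\mathbb{O}$; the sign $\mathrm{tsgn}$ takes values in $\{\oplus,\ominus,\bullet,\mathbb{O}\}$. Addition on $\mathbb{S}$: $x\oplus y$ equals $x$ if $|x|>|y|$, $y$ if $|y|>|x|$, $x$ if $|x|=|y|$ and $\mathrm{tsgn}(x)=\mathrm{tsgn}(y)$, and $\bullet|x|$ if $|x|=|y|$ and the signs differ. Multiplication: $x\odot y$ has norm $|x|+|y|$ and sign the product of signs (with $\oplus,\ominus,\bullet$ multiplying like $1,-1,0$); $\mathbb{O}$ is absorbing. The multiplicative unit is the real number $0$. Closed tropical halfspaces. For $a=(a_0,\dots,a_d)\in\mathbb{T}_{\pm}^{d+1}$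 with $(a_1,\dots,a_d)\ne(\mathbb{O},\dots,\mathbb{O})$, $\overline{\mathcal{H}}^+(a)=\{x\in\mathbb{T}_{\pm}^d: a_0\oplus a_1\odot x_1\oplus\dots\oplus a_d\odot x_d\in\mathbb{T}_{>\mathbb{O}}\cup\mathbb{T}_{\bullet}\}$. An empty intersection of halfspaces is $\mathbb{T}_{\pm}^d$. TC-convexity. For two points $x,y\in\mathbb{T}_{\pm}^d$, $\mathrm{conv}_{TC}(x,y)$ is defined as the intersection of all closed halfspaces $\overline{\mathcal{H}}^+(a)$ containing both $x$ and $y$. A set $S\subseteq\mathbb{T}_{\pm}^d$ is TC-convex if $\mathrm{conv}_{TC}(x,y)\subseteq S$ for all $x,y\in S$. For an arbitrary set $M\subseteq\mathbb{T}_{\pm}^d$, $\mathrm{conv}_{TC}(M)$ is the intersection of all TC-convex sets containing $M$. *)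

theory Defs
  imports "HOL-Library.Extended_Real" "HOL-Analysis.Finite_Cartesian_Product"
begin

text \<open>The symmetrized tropical semiring: \<open>TZero\<close> is $-\infty$, while \<open>TPos r\<close>,
  \<open>TNeg r\<close>, \<open>TBal r\<close> stand for $r$, $\ominus r$, $\bullet r$.\<close>

datatype symtrop = TZero | TPos real | TNeg real | TBal real

datatype tsign = SPlus | SMinus | SBal | SZero

fun tnorm :: "symtrop \<Rightarrow> ereal" where
  "tnorm TZero = -\<infinity>"
| "tnorm (TPos r) = ereal r"
| "tnorm (TNeg r) = ereal r"
| "tnorm (TBal r) = ereal r"

fun tsgn :: "symtrop \<Rightarrow> tsign" where
  "tsgn TZero = SZero"
| "tsgn (TPos r) = SPlus"
| "tsgn (TNeg r) = SMinus"
| "tsgn (TBal r) = SBal"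

instantiation symtrop :: comm_semiring_1
begin

definition zero_symtrop :: symtrop where
  "0 = TZero"

text \<open>The multiplicative unit is the real number $0$, not $1$.\<close>

definition one_symtrop :: symtrop where
  "1 = TPos 0"

text \<open>In the last branch the norm is finite: two elements of norm $-\infty$ are both
  \<open>TZero\<close> and so have equal signs.\<close>

definition plus_symtrop :: "symtrop \<Rightarrow> symtrop \<Rightarrow> symtrop" where
  "x + y =
    (if tnorm x > tnorm y then x
     else if tnorm y > tnorm x then y
     else if tsgn x = tsgn y then x
     else TBal (real_of_ereal (tnorm x)))"

fun times_symtrop :: "symtrop \<Rightarrow> symtrop \<Rightarrow> symtrop" where
  "TZero * y = TZero"
| "x * TZero = TZero"
| "TPos r * TPos s = TPos (r + s)"
| "TPos r * TNeg s = TNeg (r + s)"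
| "TPos r * TBal s = TBal (r + s)"
| "TNeg r * TPos s = TNeg (r + s)"
| "TNeg r * TNeg s = TPos (r + s)"
| "TNeg r * TBal s = TBal (r + s)"
| "TBal r * TPos s = TBal (r + s)"
| "TBal r * TNeg s = TBal (r + s)"
| "TBal r * TBal s = TBal (r + s)"

instance
proof
  fix a b c :: symtrop
  show "a + b + c = a + (b + c)"
    by (cases a; cases b; cases c) (simp_all add: plus_symtrop_def)
  show "a + b = b + a"
    by (cases a; cases b) (auto simp: plus_symtrop_def)
  show "0 + a = a"
    by (cases a) (simp_all add: plus_symtrop_def zero_symtrop_def)
  show "a * b * c = a * (b * c)"
    by (cases a; cases b; cases c) simp_all
  show "a * b = b * a"
    by (cases a; cases b) simp_all
  show "1 * a = a"
    by (cases a) (simp_all add: one_symtrop_def)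
  show "(a + b) * c = a * c + b * c"
    by (cases a; cases b; cases c) (simp_all add: plus_symtrop_def)
  show "0 * a = 0" "a * 0 = 0"
    by (cases a; simp add: zero_symtrop_def)+
  show "(0 :: symtrop) \<noteq> 1"
    by (simp add: zero_symtrop_def one_symtrop_def)
qed

end

definition positive_trop :: "symtrop set" where
  "positive_trop = range TPos"

definition negative_trop :: "symtrop set" where
  "negative_trop = range TNeg"

definition signed_trop :: "symtrop set" where
  "signed_trop = positive_trop \<union> negative_trop \<union> {0}"

definition balanced_trop :: "symtrop set" where
  "balanced_trop = range TBal \<union> {0}"

definition signed_space :: "(symtrop ^ 'd::finite) set" where
  "signed_space = {x. \<forall>i. x $ i \<in> signed_trop}"

text \<open>The coefficient vector $(a_0, a_1, \dots, a_d)$ is split into \<open>a0\<close> and \<open>a\<close>.\<close>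

definition closed_halfspace :: "symtrop \<Rightarrow> symtrop ^ 'd::finite \<Rightarrow> (symtrop ^ 'd) set" where
  "closed_halfspace a0 a =
    {x \<in> signed_space. a0 + (\<Sum>i\<in>UNIV. a $ i * x $ i) \<in> positive_trop \<union> balanced_trop}"

definition closed_halfspaces :: "(symtrop ^ 'd::finite) set set" where
  "closed_halfspaces =
    {closed_halfspace a0 a | a0 a. a0 \<in> signed_trop \<and> a \<in> signed_space \<and> a \<noteq> 0}"

text \<open>Intersecting with \<^const>\<open>signed_space\<close> makes an empty intersection of halfspaces equal
  to the whole space of signed points.\<close>

definition halfspace_hull :: "(symtrop ^ 'd::finite) set \<Rightarrow> (symtrop ^ 'd) set" where
  "halfspace_hull M = signed_space \<inter> \<Inter>{H \<in> closed_halfspaces. M \<subseteq> H}"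

definition TC_segment :: "symtrop ^ 'd::finite \<Rightarrow> symtrop ^ 'd \<Rightarrow> (symtrop ^ 'd) set" where
  "TC_segment x y = halfspace_hull {x, y}"

definition TC_convex :: "(symtrop ^ 'd::finite) set \<Rightarrow> bool" where
  "TC_convex S \<longleftrightarrow> S \<subseteq> signed_space \<and> (\<forall>x\<in>S. \<forall>y\<in>S. TC_segment x y \<subseteq> S)"

definition TC_hull :: "(symtrop ^ 'd::finite) set \<Rightarrow> (symtrop ^ 'd) set" where
  "TC_hull M = \<Inter>{S. TC_convex S \<and> M \<subseteq> S}"

end

theory Submission
  imports Defs
begin

text \<open>Homogenizing a TC-convex set gives a cone of signed vectors that is closed under
  positive scaling, under the left sum (at each coordinate take the entry of larger norm, the first one
  in case of a tie), and under elimination of a coordinate at which two vectors cancel, provided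
  that they cancel nowhere else. These are the only properties of segments that the proof
  needs. Given a finite subset of such a cone and a signed point outside of it, a
  separating normal vector is found by a tropical form of Fourier-Motzkin elimination: once the sign of a
  coefficient is chosen, the bounds on its norm are compatible provided that finitely many left sums,
  which again lie in the cone, satisfy the remaining inequalities. If all choices of signs fail, each of them
  leaves a witness in the cone, and eliminating the coordinates from these witnesses one at a
  time produces the point itself, a contradiction.\<close>

text \<open>A TC-convex set need not be topologically closed, so a point outside of it cannot always
  be separated from the whole set. Only the finite set \<open>X\<close> is separated; the cone is
  there to contain the combinations that the proof forms. The obstacle is the proviso on
  cancellation: two vectors that cancel at several coordinates admit no elimination. After
  rescaling, the target has entries \<open>TPos 0\<close> on a set \<open>Z\<close> and
  \<open>TZero\<close> elsewhere, so norm 0 becomes a common level. Suppose that a vector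
  \<open>g\<close> of the cone agrees with the target except at one coordinate \<open>q\<close>,
  where it lies below the level. Adding \<open>g\<close> on the left overwrites all entries of norm
  at most 0 away from \<open>q\<close>, and larger entries are kept on a prescribed side, so
  cancellation remains only where it is wanted. Where no such \<open>g\<close> exists, vectors that
  agree with the target off one coordinate are at or above the level there; scaled down, they have
  the target as their left sum.\<close>

lemma signed_trop_iff: "a \<in> signed_trop \<longleftrightarrow> (\<forall>r. a \<noteq> TBal r)"
  by (cases a) (auto simp: signed_trop_def positive_trop_def negative_trop_def zero_symtrop_def)

lemma times_TZero [simp]: "a * TZero = TZero"
  by (cases a) auto

definition signed_vec :: "('n \<Rightarrow> symtrop) \<Rightarrow> bool" where
  "signed_vec x \<longleftrightarrow> (\<forall>i. x i \<in> signed_trop)"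

text \<open>On sign vectors this is the composition of covectors of an oriented matroid.\<close>

definition left_sum :: "symtrop \<Rightarrow> symtrop \<Rightarrow> symtrop" where
  "left_sum a b = (if tnorm b \<le> tnorm a then a else b)"

definition lsum :: "('n \<Rightarrow> symtrop) \<Rightarrow> ('n \<Rightarrow> symtrop) \<Rightarrow> 'n \<Rightarrow> symtrop" where
  "lsum x y = (\<lambda>i. left_sum (x i) (y i))"

definition scale :: "real \<Rightarrow> ('n \<Rightarrow> symtrop) \<Rightarrow> 'n \<Rightarrow> symtrop" where
  "scale r x = (\<lambda>i. TPos r * x i)"

definition opposite :: "symtrop \<Rightarrow> symtrop \<Rightarrow> bool" where
  "opposite a b \<longleftrightarrow> (\<exists>r. a = TPos r \<and> b = TNeg r \<or> a = TNeg r \<and> b = TPos r)"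

text \<open>Without the proviso elimination is unsound for halfspaces:
  \<open>(TPos 0, TPos 0)\<close> and \<open>(TNeg 0, TNeg 0)\<close> both give a balanced sum with
  the normal \<open>(TNeg 0, TPos 0)\<close>, but \<open>(TZero, TPos 0)\<close> gives a positive
  one.\<close>

definition tc_cone :: "('n \<Rightarrow> symtrop) set \<Rightarrow> bool" where
  "tc_cone C \<longleftrightarrow>
    (\<forall>x\<in>C. signed_vec x) \<and>
    (\<forall>x\<in>C. \<forall>r. scale r x \<in> C) \<and>
    (\<forall>x\<in>C. \<forall>y\<in>C. lsum x y \<in> C) \<and>
    (\<forall>x\<in>C. \<forall>y\<in>C. \<forall>v. opposite (x v) (y v) \<longrightarrow> (\<forall>i. i \<noteq> v \<longrightarrow> \<not> opposite (x i) (y i))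
      \<longrightarrow> (lsum x y)(v := TZero) \<in> C)"

text \<open>For \<open>t = -\<infinity>\<close> this says that \<open>b \<cdot> x\<close> is negative or balanced, so that \<open>-b\<close> is the
  normal of a closed halfspace containing \<open>x\<close>. A finite threshold \<open>t\<close> acts like an additional negative
  term infinitesimally below \<open>t\<close>; it encodes strict upper bounds on coefficients of \<open>b\<close>.\<close>

definition sat :: "('n \<Rightarrow> symtrop) \<Rightarrow> ('n \<Rightarrow> symtrop) \<Rightarrow> ereal \<Rightarrow> bool" where
  "sat b x t \<longleftrightarrow>
    (\<forall>i p. b i * x i = TPos p \<longrightarrow> (\<exists>j n. b j * x j = TNeg n \<and> p \<le> n) \<or> ereal p < t)"

section \<open>Left sums and products of signed numbers\<close>

lemma left_sum_cases: "left_sum a b = a \<and> tnorm b \<le> tnorm a \<or> left_sum a b = b \<and> tnorm a < tnorm b"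
  by (auto simp: left_sum_def)

lemma tnorm_left_sum: "tnorm (left_sum a b) = max (tnorm a) (tnorm b)"
  by (auto simp: left_sum_def max_def)

lemma left_sum_signed: "a \<in> signed_trop \<Longrightarrow> b \<in> signed_trop \<Longrightarrow> left_sum a b \<in> signed_trop"
  by (auto simp: left_sum_def)

lemma left_sum_commute:
  "a \<in> signed_trop \<Longrightarrow> b \<in> signed_trop \<Longrightarrow> \<not> opposite a b \<Longrightarrow> left_sum a b = left_sum b a"
  by (cases a; cases b) (auto simp: left_sum_def opposite_def signed_trop_iff)

lemma not_opposite_TZero [simp]: "\<not> opposite TZero a" "\<not> opposite a TZero"
  by (auto simp: opposite_def)

lemma opposite_commute: "opposite a b \<longleftrightarrow> opposite b a"
  by (auto simp: opposite_def)

lemma times_signed: "a \<in> signed_trop \<Longrightarrow> b \<in> signed_trop \<Longrightarrow> a * b \<in> signed_trop"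
  by (cases a; cases b) (auto simp: signed_trop_iff)

lemma signed_vec_lsum: "signed_vec x \<Longrightarrow> signed_vec y \<Longrightarrow> signed_vec (lsum x y)"
  by (simp add: signed_vec_def lsum_def left_sum_signed)

lemma signed_vec_scale: "signed_vec x \<Longrightarrow> signed_vec (scale r x)"
  by (simp add: signed_vec_def scale_def times_signed signed_trop_iff[of "TPos r"])

lemma signed_vec_upd: "signed_vec x \<Longrightarrow> a \<in> signed_trop \<Longrightarrow> signed_vec (x(v := a))"
  by (simp add: signed_vec_def)

lemma tnorm_times_TPos: "tnorm (TPos r * a) = tnorm a + ereal r"
  by (cases a) auto

lemma mult_dominated:
  assumes "a * x = TPos p \<or> a * x = TNeg p" "tnorm x \<le> tnorm y" "y \<in> signed_trop"
  obtains p' where "p \<le> p'" "a * y = TPos p' \<or> a * y = TNeg p'"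
  using assms by (cases a; cases x; cases y) (auto simp: signed_trop_iff)

lemma opposite_mult:
  assumes "opposite x y" "a * x = TNeg n"
  shows "a * y = TPos n"
  using assms by (cases a) (auto simp: opposite_def)

section \<open>Halfspace inequalities under the cone operations\<close>

text \<open>Compensating a largest positive product is enough. The maximality gained here is what
  later forces any larger product to be negative.\<close>

lemma satI_max:
  fixes b x :: "'n::finite \<Rightarrow> symtrop"
  assumes "\<And>i p. b i * x i = TPos p \<Longrightarrow> (\<And>j q. b j * x j = TPos q \<Longrightarrow> q \<le> p) \<Longrightarrow>
      \<exists>j n. b j * x j = TNeg n \<and> p \<le> n"
  shows "sat b x t"
proof -
  have "\<exists>j n. b j * x j = TNeg n \<and> p \<le> n" if ip: "b i * x i = TPos p" for i p
  proof -
    let ?P = "{q. \<exists>j. b j * x j = TPos q}"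
    have "?P \<subseteq> (\<lambda>j. THE q. b j * x j = TPos q) ` UNIV"
      by (auto simp: image_iff intro!: exI the_equality[symmetric])
    then have fin: "finite ?P"
      by (rule finite_subset) simp
    from ip have ne: "p \<in> ?P"
      by blast
    have "Max ?P \<in> ?P" "p \<le> Max ?P"
      using fin ne Max_in Max_ge by blast+
    then obtain k where k: "b k * x k = TPos (Max ?P)"
      by blast
    have "\<exists>j n. b j * x j = TNeg n \<and> Max ?P \<le> n"
      using k fin by (intro assms[OF k]) (auto intro: Max_ge)
    with \<open>p \<le> Max ?P\<close> show ?thesis
      by (meson order_trans)
  qed
  then show ?thesis
    by (auto simp: sat_def)
qed

lemma sat_minf: "sat b x (-\<infinity>) \<Longrightarrow> b i * x i = TPos p \<Longrightarrow> \<exists>j n. b j * x j = TNeg n \<and> p \<le> n"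
  by (auto simp: sat_def)

text \<open>If a compensating negative entry of \<open>x\<close> is overwritten by a larger entry of
  \<open>y\<close>, the new product exceeds \<open>p\<close>, so by maximality it is again negative.
  For an entry of \<open>y\<close> the overwriting may also happen at a tie.\<close>

lemma sat_lsum:
  fixes b x y :: "'n::finite \<Rightarrow> symtrop"
  assumes x: "sat b x (-\<infinity>)" "signed_vec x" and y: "sat b y (-\<infinity>)" "signed_vec y"
  shows "sat b (lsum x y) (-\<infinity>)"
proof (rule satI_max)
  fix i p
  assume ip: "b i * lsum x y i = TPos p"
    and mx: "\<And>j q. b j * lsum x y j = TPos q \<Longrightarrow> q \<le> p"
  have sg: "lsum x y j \<in> signed_trop" for j
    using signed_vec_lsum[OF x(2) y(2)] by (simp add: signed_vec_def)
  have 1: "\<exists>j n. b j * lsum x y j = TNeg n \<and> p \<le> n"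
    if i: "b i * x i = TPos p" for i
  proof -
    obtain j n where j: "b j * x j = TNeg n" "p \<le> n"
      using sat_minf[OF x(1) i] by blast
    from left_sum_cases[of "x j" "y j"] show ?thesis
    proof
      assume "left_sum (x j) (y j) = x j \<and> tnorm (y j) \<le> tnorm (x j)"
      with j show ?thesis by (metis lsum_def)
    next
      assume l: "left_sum (x j) (y j) = y j \<and> tnorm (x j) < tnorm (y j)"
      have "y j \<in> signed_trop" using y(2) by (simp add: signed_vec_def)
      then obtain n' where n': "n \<le> n'" "b j * y j = TPos n' \<or> b j * y j = TNeg n'"
        using mult_dominated[of "b j" "x j" n "y j"] j l by (metis less_imp_le)
      have "n' \<noteq> n"
        using l j n'(2) by (cases "b j"; cases "x j"; cases "y j") auto
      with n' j mx[of j n'] l have "b j * lsum x y j = TNeg n'"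
        by (auto simp: lsum_def)
      with n' j show ?thesis
        by (meson order_trans)
    qed
  qed
  from left_sum_cases[of "x i" "y i"]
  show "\<exists>j n. b j * lsum x y j = TNeg n \<and> p \<le> n"
  proof
    assume "left_sum (x i) (y i) = x i \<and> tnorm (y i) \<le> tnorm (x i)"
    with ip 1[of i] show ?thesis by (simp add: lsum_def)
  next
    assume l: "left_sum (x i) (y i) = y i \<and> tnorm (x i) < tnorm (y i)"
    with ip obtain j n where j: "b j * y j = TNeg n" "p \<le> n"
      using sat_minf[OF y(1)] by (metis lsum_def)
    from left_sum_cases[of "x j" "y j"] show ?thesis
    proof
      assume l: "left_sum (x j) (y j) = x j \<and> tnorm (y j) \<le> tnorm (x j)"
      have "x j \<in> signed_trop" using x(2) by (simp add: signed_vec_def)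
      then obtain n' where n': "n \<le> n'" "b j * x j = TPos n' \<or> b j * x j = TNeg n'"
        using mult_dominated[of "b j" "y j" n "x j"] j l by metis
      from n'(2) show ?thesis
      proof
        \<comment> \<open>Maximality of \<open>p\<close> leaves only a tie. The product with
          \<open>x j\<close> is then itself positive of norm \<open>p\<close>, and the inequality
          for \<open>x\<close> compensates it.\<close>
        assume "b j * x j = TPos n'"
        with mx[of j n'] l n' j have "b j * x j = TPos p"
          by (simp add: lsum_def)
        then show ?thesis by (rule 1)
      next
        assume "b j * x j = TNeg n'"
        with n' j l have "b j * lsum x y j = TNeg n'" "p \<le> n'"
          by (simp_all add: lsum_def)
        then show ?thesis by blast
      qed
    next
      assume "left_sum (x j) (y j) = y j \<and> tnorm (x j) < tnorm (y j)"
      with j have "b j * lsum x y j = TNeg n" "p \<le> n"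
        by (simp_all add: lsum_def)
      then show ?thesis by blast
    qed
  qed
qed

text \<open>If the compensating product of one vector sits at the deleted coordinate
  \<open>v\<close>, cancellation turns it into a positive product of the other vector, whose
  inequality yields a negative product at least as large away from \<open>v\<close>. As nothing else
  cancels, the left sum commutes off \<open>v\<close> and the two vectors are
  interchangeable.\<close>

lemma sat_elim:
  fixes b x y :: "'n::finite \<Rightarrow> symtrop"
  assumes x: "sat b x (-\<infinity>)" "signed_vec x" and y: "sat b y (-\<infinity>)" "signed_vec y"
    and v: "opposite (x v) (y v)" and no: "\<And>i. i \<noteq> v \<Longrightarrow> \<not> opposite (x i) (y i)"
  shows "sat b ((lsum x y)(v := TZero)) (-\<infinity>)"
proof (rule satI_max)
  fix i p
  let ?f = "(lsum x y)(v := TZero)"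
  assume ip: "b i * ?f i = TPos p"
    and mx: "\<And>j q. b j * ?f j = TPos q \<Longrightarrow> q \<le> p"
  have iv: "i \<noteq> v"
    using ip by auto
  have neg: "\<exists>k n'. b k * ?f k = TNeg n' \<and> p \<le> n'"
    if k: "k \<noteq> v" and fk: "?f k = left_sum (x' k) (y' k)"
      and s: "signed_vec x'" "signed_vec y'" and no: "\<not> opposite (x' k) (y' k)"
      and n: "b k * x' k = TNeg n" "p \<le> n"
    for x' y' k n
  proof -
    from left_sum_cases[of "x' k" "y' k"] show ?thesis
    proof
      assume "left_sum (x' k) (y' k) = x' k \<and> tnorm (y' k) \<le> tnorm (x' k)"
      with n fk show ?thesis by metis
    next
      assume l: "left_sum (x' k) (y' k) = y' k \<and> tnorm (x' k) < tnorm (y' k)"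
      have "y' k \<in> signed_trop" using s by (simp add: signed_vec_def)
      then obtain n' where n': "n \<le> n'" "b k * y' k = TPos n' \<or> b k * y' k = TNeg n'"
        using mult_dominated[of "b k" "x' k" n "y' k"] n l by (metis less_imp_le)
      have "n' \<noteq> n"
        using l n n'(2) by (cases "b k"; cases "x' k"; cases "y' k") auto
      with n' n mx[of k n'] l fk have "b k * ?f k = TNeg n'" "p \<le> n'"
        by auto
      then show ?thesis by blast
    qed
  qed
  have main: "\<exists>k n'. b k * ?f k = TNeg n' \<and> p \<le> n'"
    if i: "b i * x' i = TPos p"
      and f: "\<And>k. k \<noteq> v \<Longrightarrow> ?f k = left_sum (x' k) (y' k)"
      and x: "sat b x' (-\<infinity>)" "signed_vec x'" and y: "sat b y' (-\<infinity>)" "signed_vec y'"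
      and v: "opposite (x' v) (y' v)" and no: "\<And>i. i \<noteq> v \<Longrightarrow> \<not> opposite (x' i) (y' i)"
    for x' y'
  proof -
    obtain j n where j: "b j * x' j = TNeg n" "p \<le> n"
      using sat_minf[OF x(1) i] by blast
    show ?thesis
    proof (cases "j = v")
      case False
      show ?thesis
        by (rule neg[OF False f[OF False] x(2) y(2) no[OF False] j])
    next
      case True
      then have "b v * y' v = TPos n"
        using j opposite_mult[OF v] by blast
      then obtain k n2 where k: "b k * y' k = TNeg n2" "n \<le> n2"
        using sat_minf[OF y(1)] by blast
      have kv: "k \<noteq> v"
        using k \<open>b v * y' v = TPos n\<close> by auto
      have no': "\<not> opposite (y' k) (x' k)"
        using no[OF kv] by (simp add: opposite_commute)
      have "?f k = left_sum (y' k) (x' k)"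
          using left_sum_commute[OF _ _ no[OF kv]] x(2) y(2)
        unfolding f[OF kv] signed_vec_def by blast
      then show ?thesis
        using neg[OF kv _ y(2) x(2) no' k(1)] k(2) j(2) by auto
    qed
  qed
  have f1: "?f k = left_sum (x k) (y k)" if "k \<noteq> v" for k
    using that by (simp add: lsum_def)
  have f2: "?f k = left_sum (y k) (x k)" if "k \<noteq> v" for k
    using left_sum_commute[OF _ _ no[OF that]] x(2) y(2)
    unfolding f1[OF that] signed_vec_def by blast
  have no': "\<not> opposite (y k) (x k)" if "k \<noteq> v" for k
    using no[OF that] by (simp add: opposite_commute)
  from left_sum_cases[of "x i" "y i"]
  show "\<exists>j n. b j * ?f j = TNeg n \<and> p \<le> n"
  proof
    assume "left_sum (x i) (y i) = x i \<and> tnorm (y i) \<le> tnorm (x i)"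
    then have "b i * x i = TPos p"
      using ip f1[OF iv] by simp
    then show ?thesis
      by (rule main[OF _ f1 x y v no])
  next
    assume "left_sum (x i) (y i) = y i \<and> tnorm (x i) < tnorm (y i)"
    then have "b i * y i = TPos p"
      using ip f1[OF iv] by simp
    then show ?thesis
      by (rule main[OF _ f2 y x opposite_commute[THEN iffD1, OF v] no'])
  qed
qed

lemma sat_scale: "sat b (scale r x) (t + ereal r) \<longleftrightarrow> sat b x t"
proof -
  have P: "b i * scale r x i = TPos p \<longleftrightarrow> b i * x i = TPos (p - r)"
    and N: "b i * scale r x i = TNeg p \<longleftrightarrow> b i * x i = TNeg (p - r)" for i p
    by (cases "b i"; cases "x i"; auto simp: scale_def)+
  have T: "ereal p < t + ereal r \<longleftrightarrow> ereal (p - r) < t" for p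
    by (cases t) auto
  have E: "(\<forall>p. Q (p - r)) \<longleftrightarrow> (\<forall>p. Q p)" "(\<exists>p. Q (p - r)) \<longleftrightarrow> (\<exists>p. Q p)" for Q
    by (metis add_diff_cancel_right')+
  have "(\<exists>j n. b j * scale r x j = TNeg n \<and> p \<le> n) \<longleftrightarrow> (\<exists>j n. b j * x j = TNeg n \<and> p - r \<le> n)" for p
    unfolding N using E(2)[of "\<lambda>n. b j * x j = TNeg n \<and> p - r \<le> n" for j] by simp
  then show ?thesis
    unfolding sat_def P T
    using E(1)[of "\<lambda>p. b i * x i = TPos p \<longrightarrow> (\<exists>j n. b j * x j = TNeg n \<and> p \<le> n) \<or> ereal p < t" for i]
    by simp
qed

subsection \<open>Tropical Fourier-Motzkin elimination\<close>

abbreviation signed_real :: "bool \<Rightarrow> real \<Rightarrow> symtrop" where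
  "signed_real s r \<equiv> (if s then TPos r else TNeg r)"

text \<open>Phrased by exclusion, so that \<open>TZero\<close> lies on both sides.\<close>

definition sided :: "bool \<Rightarrow> symtrop \<Rightarrow> bool" where
  "sided s a \<longleftrightarrow> (\<forall>r. a \<noteq> signed_real (\<not> s) r)"

text \<open>The threshold transforms like the norm of one more entry. Elimination is not demanded:
  with the sign of each coefficient fixed, bounds combine through left sums alone, and these keep
  entries on their side.\<close>

definition pair_cone :: "(('n \<Rightarrow> symtrop) \<times> ereal) set \<Rightarrow> bool" where
  "pair_cone D \<longleftrightarrow>
    (\<forall>x t. (x, t) \<in> D \<longrightarrow> signed_vec x) \<and>
    (\<forall>x t r. (x, t) \<in> D \<longrightarrow> (scale r x, t + ereal r) \<in> D) \<and>
    (\<forall>x t y u. (x, t) \<in> D \<longrightarrow> (y, u) \<in> D \<longrightarrow> (lsum x y, max t u) \<in> D)"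

lemma sided_TZero [simp]: "sided s TZero"
  by (simp add: sided_def)

lemma sided_signed_real [simp]: "sided s (signed_real s m)"
  by (simp add: sided_def)

lemma sided_scale [simp]: "sided s (TPos r * a) \<longleftrightarrow> sided s a"
  by (cases a) (auto simp: sided_def)

lemma sided_left_sum: "sided s a \<Longrightarrow> sided s b \<Longrightarrow> sided s (left_sum a b)"
  by (simp add: left_sum_def)

lemma pair_coneD:
  assumes "pair_cone D" "(x, t) \<in> D"
  shows "signed_vec x" "(scale r x, t + ereal r) \<in> D"
    "(y, u) \<in> D \<Longrightarrow> (lsum x y, max t u) \<in> D"
  using assms by (auto simp: pair_cone_def)

text \<open>The coefficient of \<open>w\<close> is bounded below by the vectors \<open>x\<close> on which it acts negatively and above
  by the vectors \<open>y\<close> on which it acts positively. Such a pair of bounds is compatible as soon as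
  the left sum of \<open>y\<close> and the multiple of \<open>x\<close> that ties with it at \<open>w\<close> is satisfied.\<close>

lemma fourier_motzkin:
  fixes Y :: "(('n::finite \<Rightarrow> symtrop) \<times> ereal) set"
  assumes D: "pair_cone D" and Y: "finite Y" "Y \<subseteq> D"
  obtains Y' where "finite Y'" "Y' \<subseteq> {(x, t) \<in> D. sided s (x w)}"
    "\<And>b. b w = TZero \<Longrightarrow> \<forall>(x, t)\<in>Y'. sat b x t \<Longrightarrow>
      \<exists>a\<in>signed_trop. sided s a \<and> (\<forall>(x, t)\<in>Y. sat (b(w := a)) x t)"
proof -
  define mag where "mag a = real_of_ereal (tnorm a)" for a
  define S where "S = {((y, u), (x, t)) \<in> Y \<times> Y.
    (\<exists>m. y w = signed_real s m) \<and> (\<exists>m. x w = signed_real (\<not> s) m)}"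
  \<comment> \<open>The tie at \<open>w\<close> keeps the entry of the first vector, so the
    combination lies on side \<open>s\<close>.\<close>
  define f where "f = (\<lambda>((y :: 'n \<Rightarrow> symtrop, u), (x, t)).
    (lsum y (scale (mag (y w) - mag (x w)) x), max u (t + ereal (mag (y w) - mag (x w)))))"
  define Y' where "Y' = {(y, u) \<in> Y. sided s (y w)} \<union> f ` S"
  have mag: "mag (signed_real c m) = m" for c m
    by (simp add: mag_def)
  have "S \<subseteq> Y \<times> Y"
    by (auto simp: S_def)
  then have "finite S"
    using Y finite_subset by blast
  moreover have "finite {(y, u) \<in> Y. sided s (y w)}"
    using Y by (auto intro: finite_subset[of _ Y])
  ultimately have fin: "finite Y'"
    by (simp add: Y'_def)
  have "f ((y, u), (x, t)) \<in> {(x, t) \<in> D. sided s (x w)}" if "((y, u), (x, t)) \<in> S" for y u x t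
  proof -
    from that obtain m m' where *: "(y, u) \<in> Y" "(x, t) \<in> Y" "y w = signed_real s m" "x w = signed_real (\<not> s) m'"
      by (auto simp: S_def)
    have "(scale (m - m') x, t + ereal (m - m')) \<in> D"
      using pair_coneD(2)[OF D] * Y by blast
    then have "(lsum y (scale (m - m') x), max u (t + ereal (m - m'))) \<in> D"
      using pair_coneD(3)[OF D] * Y by blast
    moreover have "lsum y (scale (m - m') x) w = y w"
      using * by (auto simp: lsum_def left_sum_def scale_def)
    ultimately show ?thesis
      using * by (auto simp: f_def mag sided_def)
  qed
  then have "f ` S \<subseteq> {(x, t) \<in> D. sided s (x w)}"
    by (intro image_subsetI) (simp only: split_paired_all)
  moreover have "{(y, u) \<in> Y. sided s (y w)} \<subseteq> {(x, t) \<in> D. sided s (x w)}"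
    using Y by auto
  ultimately have sub: "Y' \<subseteq> {(x, t) \<in> D. sided s (x w)}"
    by (simp add: Y'_def)
  have "\<exists>a\<in>signed_trop. sided s a \<and> (\<forall>(x, t)\<in>Y. sat (b(w := a)) x t)"
    if b: "b w = TZero" and sat: "\<forall>(x, t)\<in>Y'. sat b x t" for b
  proof -
    have satY: "sat b x t" if "(x, t) \<in> Y" "sided s (x w)" for x t
      using that sat unfolding Y'_def by blast
    define lacking where "lacking x t i p \<longleftrightarrow>
      b i * x i = TPos p \<and> \<not> (\<exists>j n. b j * x j = TNeg n \<and> p \<le> n) \<and> \<not> ereal p < t" for x t i p
    \<comment> \<open>\<open>p - m\<close> is the least norm for which a coefficient of sign
      \<open>s\<close> produces a negative product at \<open>w\<close> that compensates
      \<open>p\<close>.\<close>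
    define B where "B = {p - m |p m x t i. (x, t) \<in> Y \<and> x w = signed_real (\<not> s) m \<and> lacking x t i p}"
    have "B \<subseteq> (\<lambda>((x, t), i). mag (b i * x i) - mag (x w)) ` (Y \<times> UNIV)"
    proof
      fix r assume "r \<in> B"
      then obtain p m x t i where "r = p - m" "(x, t) \<in> Y" "x w = signed_real (\<not> s) m" "lacking x t i p"
        unfolding B_def by blast
      then show "r \<in> (\<lambda>((x, t), i). mag (b i * x i) - mag (x w)) ` (Y \<times> UNIV)"
        using mag by (intro image_eqI[of _ _ "((x, t), i)"]) (auto simp: lacking_def mag_def)
    qed
    then have finB: "finite B"
      by (rule finite_subset) (use Y in simp)
    have upd: "(b(w := a)) j * x j = b j * x j" if "b j * x j \<noteq> TZero" for a x j
      using that b by (cases "j = w") simp_all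
    have sat_upd: "sat (b(w := a)) x t"
      if "\<And>i p. (b(w := a)) i * x i = TPos p \<Longrightarrow> i = w \<or> lacking x t i p \<Longrightarrow>
        (\<exists>j n. (b(w := a)) j * x j = TNeg n \<and> p \<le> n) \<or> ereal p < t" for a x t
      unfolding sat_def
    proof (intro allI impI)
      fix i p assume ip: "(b(w := a)) i * x i = TPos p"
      show "(\<exists>j n. (b(w := a)) j * x j = TNeg n \<and> p \<le> n) \<or> ereal p < t"
      proof (cases "i = w \<or> lacking x t i p")
        case False
        then have "(\<exists>j n. b j * x j = TNeg n \<and> p \<le> n) \<or> ereal p < t"
          using ip by (auto simp: lacking_def)
        then show ?thesis
          using upd by (metis symtrop.distinct(3))
      qed (use that ip in blast)
    qed
    show ?thesis
    proof (cases "B = {}")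
      case True
      have "sat (b(w := TZero)) x t" if "(x, t) \<in> Y" for x t
      proof (cases "sided s (x w)")
        case True
        then have "sat b x t"
          by (rule satY[OF that])
        then show ?thesis
          using b by (metis fun_upd_triv)
      next
        case False
        then show ?thesis
          using that \<open>B = {}\<close> by (intro sat_upd) (auto simp: B_def sided_def)
      qed
      then show ?thesis
        by (intro bexI[of _ TZero]) (auto simp: signed_trop_iff)
    next
      case False
      \<comment> \<open>The smallest norm that meets all lower bounds; only the upper bounds remain
        to be checked.\<close>
      define r where "r = Max B"
      have "sat (b(w := signed_real s r)) x t" if xt: "(x, t) \<in> Y" for x t
      proof (rule sat_upd)
        fix i p
        assume ip: "(b(w := signed_real s r)) i * x i = TPos p" and "i = w \<or> lacking x t i p"
        then consider "i = w" | "lacking x t i p" "i \<noteq> w"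
          by blast
        then show "(\<exists>j n. (b(w := signed_real s r)) j * x j = TNeg n \<and> p \<le> n) \<or> ereal p < t"
        proof cases
          case 1
          with ip obtain m where m: "x w = signed_real s m" "p = r + m"
            by (cases "x w"; cases s) auto
          have satx: "sat b x t"
            using satY[OF xt] m(1) sided_signed_real by metis
          have "r \<in> B"
            using False finB Max_in by (simp add: r_def)
          then obtain p0 m0 y u k where y: "r = p0 - m0" "(y, u) \<in> Y" "y w = signed_real (\<not> s) m0"
              "lacking y u k p0"
            unfolding B_def by blast
          \<comment> \<open>Scaling \<open>y\<close> by \<open>l\<close> makes it tie with
            \<open>x\<close> at \<open>w\<close> and moves its uncompensated term from
            \<open>p0\<close> to \<open>p\<close>. The negative products and the threshold of the
            scaled \<open>y\<close> are too small to compensate \<open>p\<close>, so in the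
            combination the compensation has to come from \<open>x\<close>.\<close>
          define l where "l = m - m0"
          have pl: "p = p0 + l"
            using m y by (simp add: l_def)
          have "((x, t), (y, u)) \<in> S"
            using xt y(2,3) m(1) unfolding S_def by blast
          then have "f ((x, t), (y, u)) \<in> Y'"
            unfolding Y'_def by blast
          then have satf: "sat b (lsum x (scale l y)) (max t (u + ereal l))"
            using bspec[OF sat] m(1) y(3) by (fastforce simp: f_def mag l_def)
          have posy: "b k * scale l y k = TPos p"
            using y(4) pl by (cases "b k"; cases "y k") (auto simp: lacking_def scale_def)
          have negy: "n < p" if "b j * scale l y j = TNeg n" for j n
          proof -
            have "b j * y j = TNeg (n - l)"
              using that by (cases "b j"; cases "y j") (auto simp: scale_def)
            then show ?thesis
              using y(4) pl by (force simp: lacking_def)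
          qed
          have lowu: "\<not> ereal p < u + ereal l"
            using y(4) pl by (cases u) (auto simp: lacking_def)
          have "(\<exists>j n. b j * x j = TNeg n \<and> p \<le> n) \<or> ereal p < t"
            using left_sum_cases[of "x k" "scale l y k"]
          proof
            assume a: "left_sum (x k) (scale l y k) = x k \<and> tnorm (scale l y k) \<le> tnorm (x k)"
            have "x k \<in> signed_trop"
              using pair_coneD(1)[OF D] xt Y by (auto simp: signed_vec_def)
            then obtain p' where p': "p \<le> p'" "b k * x k = TPos p' \<or> b k * x k = TNeg p'"
              using mult_dominated posy a by metis
            from p'(2) show ?thesis
            proof
              assume "b k * x k = TPos p'"
              then have "(\<exists>j n. b j * x j = TNeg n \<and> p' \<le> n) \<or> ereal p' < t"
                using satx by (simp add: sat_def)
              then show ?thesis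
                using p'(1) by (meson ereal_less_eq(3) order.trans order.strict_trans1)
            qed (use p' in blast)
          next
            assume "left_sum (x k) (scale l y k) = scale l y k \<and> tnorm (x k) < tnorm (scale l y k)"
            then have "b k * lsum x (scale l y) k = TPos p"
              using posy by (simp add: lsum_def)
            then have "(\<exists>j n. b j * lsum x (scale l y) j = TNeg n \<and> p \<le> n) \<or> ereal p < t"
              using satf lowu unfolding sat_def by (metis less_max_iff_disj)
            moreover have "lsum x (scale l y) j = x j" if "b j * lsum x (scale l y) j = TNeg n" "p \<le> n" for j n
              using that negy[of j n] left_sum_cases[of "x j" "scale l y j"] by (force simp: lsum_def)
            ultimately show ?thesis
              by metis
          qed
          then show ?thesis
            using upd by (metis symtrop.distinct(3))
        next
          case 2
          show ?thesis
          proof (cases "sided s (x w)")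
            case True
            then have "sat b x t"
              by (rule satY[OF xt])
            then show ?thesis
              using 2(1) unfolding sat_def lacking_def by blast
          next
            case False
            then obtain m where m: "x w = signed_real (\<not> s) m"
              by (auto simp: sided_def)
            then have "p - m \<in> B"
              using xt 2 unfolding B_def by blast
            then have "p - m \<le> r"
              using finB by (simp add: r_def)
            then have "(b(w := signed_real s r)) w * x w = TNeg (r + m) \<and> p \<le> r + m"
              using m by auto
            then show ?thesis
              by blast
          qed
        qed
      qed
      then show ?thesis
        by (intro bexI[of _ "signed_real s r"]) (auto simp: signed_trop_iff sided_def)
    qed
  qed
  with fin sub show ?thesis
    by (intro that[of Y']) blast+
qed

text \<open>A Farkas alternative for the sign pattern \<open>\<tau>\<close>. No signed
  \<open>b\<close> with \<open>b q = TPos 0\<close>, support in \<open>insert q K\<close> and signs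
  given by \<open>\<tau>\<close> on \<open>K\<close> satisfies a pair as in the first alternative:
  no product with \<open>x\<close> is negative, and the one at \<open>q\<close> is not below
  \<open>t\<close>. The combinations formed on the way leave \<open>Y\<close> but stay in
  \<open>D\<close>, hence the certificate is found in \<open>D\<close>.\<close>

lemma fourier_motzkin_iterated:
  fixes \<tau> :: "'n::finite \<Rightarrow> bool"
  assumes "finite K" "q \<notin> K" "pair_cone D" "finite Y" "Y \<subseteq> D"
  shows "(\<exists>x t p. (x, t) \<in> D \<and> x q = TPos p \<and> t \<le> ereal p \<and> (\<forall>i\<in>K. sided (\<tau> i) (x i))) \<or>
    (\<exists>b. signed_vec b \<and> b q = TPos 0 \<and> (\<forall>i. i \<notin> insert q K \<longrightarrow> b i = TZero) \<and>
      (\<forall>(x, t)\<in>Y. sat b x t))"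
  using assms
proof (induction K arbitrary: D Y rule: finite_induct)
  case empty
  show ?case
  proof (cases "\<exists>(x, t)\<in>Y. \<exists>p. x q = TPos p \<and> t \<le> ereal p")
    case True
    with empty show ?thesis
      by blast
  next
    case False
    define b where "b = (\<lambda>_. TZero)(q := TPos 0)"
    have "sat b x t" if "(x, t) \<in> Y" for x t
      unfolding sat_def
    proof (intro allI impI disjI2)
      fix i p assume "b i * x i = TPos p"
      then have "x q = TPos p"
        by (cases "i = q"; cases "x i") (auto simp: b_def)
      then show "ereal p < t"
        using False that not_le by fastforce
    qed
    then have "\<forall>(x, t)\<in>Y. sat b x t"
      by blast
    moreover have "signed_vec b" "b q = TPos 0" "\<forall>i. i \<notin> {q} \<longrightarrow> b i = TZero"
      by (simp_all add: b_def signed_vec_def signed_trop_iff)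
    ultimately show ?thesis
      by blast
  qed
next
  case (insert w K)
  obtain Y' where Y': "finite Y'" "Y' \<subseteq> {(x, t) \<in> D. sided (\<tau> w) (x w)}"
    and ext: "\<And>b. b w = TZero \<Longrightarrow> \<forall>(x, t)\<in>Y'. sat b x t \<Longrightarrow>
      \<exists>a\<in>signed_trop. sided (\<tau> w) a \<and> (\<forall>(x, t)\<in>Y. sat (b(w := a)) x t)"
    by (rule fourier_motzkin[OF insert.prems(2-4), where w = w and s = "\<tau> w"]) blast
  have "pair_cone {(x, t) \<in> D. sided (\<tau> w) (x w)}"
    using insert.prems(2) by (simp add: pair_cone_def lsum_def scale_def sided_left_sum)
  then consider
    x t p where "(x, t) \<in> D" "sided (\<tau> w) (x w)" "x q = TPos p" "t \<le> ereal p" "\<forall>i\<in>K. sided (\<tau> i) (x i)"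
  | b where "signed_vec b" "b q = TPos 0" "\<forall>i. i \<notin> insert q K \<longrightarrow> b i = TZero" "\<forall>(x, t)\<in>Y'. sat b x t"
    using insert.IH[OF _ _ Y'] insert.prems(1) by blast
  then show ?case
  proof cases
    case 1
    then show ?thesis
      by (intro disjI1) blast
  next
    case (2 b)
    then have "b w = TZero"
      using insert.hyps(2) insert.prems(1) by auto
    from ext[OF this 2(4)] obtain a where "a \<in> signed_trop" "\<forall>(x, t)\<in>Y. sat (b(w := a)) x t"
      by blast
    moreover have "signed_vec (b(w := a))" "(b(w := a)) q = TPos 0"
        "\<forall>i. i \<notin> insert q (insert w K) \<longrightarrow> (b(w := a)) i = TZero"
      using 2 insert.prems(1) calculation(1) by (auto simp: signed_vec_upd)
    ultimately show ?thesis
      by blast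
  qed
qed

section \<open>Indicator vectors in the presence of a dominating vector\<close>

definition indicator_vec :: "'n set \<Rightarrow> 'n \<Rightarrow> symtrop" where
  "indicator_vec Z = (\<lambda>i. if i \<in> Z then TPos 0 else TZero)"

text \<open>The last conjunct says that \<open>b \<cdot> indicator_vec Z\<close> is strictly positive.\<close>

definition separated :: "('n \<Rightarrow> symtrop) set \<Rightarrow> 'n set \<Rightarrow> bool" where
  "separated X Z \<longleftrightarrow> (\<exists>b. signed_vec b \<and> (\<forall>x\<in>X. sat b x (-\<infinity>)) \<and>
    (\<exists>q\<in>Z. \<exists>p. b q = TPos p \<and> (\<forall>j\<in>Z. \<forall>n. b j = TNeg n \<longrightarrow> n < p)))"

text \<open>Norm 0 is the level of \<open>indicator_vec\<close>: a small entry is absorbed when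
  \<open>TPos 0\<close> is added to it on the left, whatever its sign.\<close>

definition sided_or_small :: "bool \<Rightarrow> symtrop \<Rightarrow> bool" where
  "sided_or_small s a \<longleftrightarrow> sided s a \<or> tnorm a \<le> 0"

lemma tc_coneD:
  assumes "tc_cone C" "x \<in> C"
  shows "signed_vec x" "scale r x \<in> C" "y \<in> C \<Longrightarrow> lsum x y \<in> C"
    "y \<in> C \<Longrightarrow> opposite (x v) (y v) \<Longrightarrow> (\<And>i. i \<noteq> v \<Longrightarrow> \<not> opposite (x i) (y i)) \<Longrightarrow>
      (lsum x y)(v := TZero) \<in> C"
  using assms unfolding tc_cone_def by blast+

lemma left_sum_TZero [simp]: "left_sum TZero a = a" "left_sum a TZero = a"
  by (cases a; simp add: left_sum_def)+

lemma lsum_zero [simp]: "lsum (\<lambda>_. TZero) x = x" "lsum x (\<lambda>_. TZero) = x"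
  by (simp_all add: lsum_def)

lemma scale_zero [simp]: "scale r (\<lambda>_. TZero) = (\<lambda>_. TZero)"
  by (simp add: scale_def)

lemma left_sum_truncated:
  assumes "c = a \<or> tnorm c \<le> t \<and> tnorm a \<le> t" "c' = a' \<or> tnorm c' \<le> u \<and> tnorm a' \<le> u"
  shows "left_sum c c' = left_sum a a' \<or>
    tnorm (left_sum c c') \<le> max t u \<and> tnorm (left_sum a a') \<le> max t u"
proof (cases "tnorm (left_sum c c') \<le> max t u \<and> tnorm (left_sum a a') \<le> max t u")
  case False
  then show ?thesis
    using assms unfolding left_sum_def by (smt (verit) max.cobounded1 max.cobounded2 order.trans linorder_le_cases)
qed simp

lemma tnorm_scale_le: "r \<le> 0 \<Longrightarrow> tnorm a \<le> 0 \<Longrightarrow> tnorm (TPos r * a) \<le> 0"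
  by (cases a) auto

lemma sided_or_small_left_sum:
  "sided_or_small s a \<Longrightarrow> sided_or_small s b \<Longrightarrow> sided_or_small s (left_sum a b)"
  by (auto simp: sided_or_small_def left_sum_def)

lemma sided_or_small_scale: "r \<le> 0 \<Longrightarrow> sided_or_small s a \<Longrightarrow> sided_or_small s (TPos r * a)"
  using tnorm_scale_le by (auto simp: sided_or_small_def)

lemma sided_not_opposite: "sided s a \<Longrightarrow> sided s b \<Longrightarrow> \<not> opposite a b"
  by (cases s) (auto simp: sided_def opposite_def)

text \<open>Left addition of \<open>g\<close> turns every small entry into \<open>TPos 0\<close>; this removes the sign conflicts that
  would forbid the elimination of \<open>w\<close>.\<close>

lemma merge_coordinate:
  fixes C :: "('n::finite \<Rightarrow> symtrop) set"
  assumes C: "tc_cone C" and support: "\<forall>x\<in>C. \<forall>i. i \<notin> Z \<longrightarrow> x i = TZero"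
    and g: "g \<in> C" "\<forall>i\<in>Z - {q}. g i = TPos 0" "tnorm (g q) < 0"
    and d: "d \<in> C" "d q = TPos 0" "d w = signed_real s p" 
    and e: "e \<in> C" "e q = TPos 0" "e w = signed_real (\<not> s) p'"
    and p: "0 < p" "p \<le> p'" and w: "w \<noteq> q"
    and R: "\<And>i. i \<noteq> q \<Longrightarrow> i \<noteq> w \<Longrightarrow> sided_or_small (\<tau> i) (d i) \<and> sided_or_small (\<tau> i) (e i)"
  obtains f where "f \<in> C" "f q = TPos 0" "tnorm (f w) \<le> 0"
    "\<And>i. i \<noteq> q \<Longrightarrow> sided_or_small (\<tau> i) (f i)"
    "\<And>i. i \<noteq> q \<Longrightarrow> tnorm (d i) \<le> 0 \<Longrightarrow> tnorm (e i) \<le> 0 \<Longrightarrow> tnorm (f i) \<le> 0"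
proof
  have supp: "x i = TZero" if "x \<in> C" "i \<notin> Z" for x i
    using support that by blast
  \<comment> \<open>Scaling \<open>e\<close> down by \<open>p' - p\<close> makes it tie with
    \<open>d\<close> at \<open>w\<close>. Coming first, it keeps its sign there, while
    \<open>d\<close> restores \<open>TPos 0\<close> at \<open>q\<close>.\<close>
  define e' where "e' = lsum (scale (p - p') e) d"
  define f where "f = (lsum (lsum g d) (lsum g e'))(w := TZero)"
  have e': "e' \<in> C" "e' q = TPos 0" "e' w = signed_real (\<not> s) p"
    using tc_coneD[OF C] e d p by (simp_all add: e'_def) (auto simp: lsum_def scale_def left_sum_def)
  have wZ: "w \<in> Z"
    using supp[OF d(1), of w] d(3) by (cases s) auto
  have gw: "g w = TPos 0"
    using g(2) w wZ by simp
  have small: "tnorm (g i) \<le> 0" if "i \<noteq> q" for i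
    using that g(2) supp[OF g(1), of i] by (cases "i \<in> Z") auto
  have gq: "left_sum (g q) (TPos 0) = TPos 0"
    using g(3) leD by (auto simp: left_sum_def zero_ereal_def)
  show "f \<in> C"
    unfolding f_def
  proof (rule tc_coneD(4)[OF C])
    show "lsum g d \<in> C" "lsum g e' \<in> C"
      using tc_coneD(3)[OF C g(1)] d(1) e'(1) by blast+
    show "opposite (lsum g d w) (lsum g e' w)"
      using d(3) e'(3) gw p by (auto simp: lsum_def left_sum_def opposite_def)
    fix i assume i: "i \<noteq> w"
    consider "i = q" | "i \<notin> Z" | "i \<in> Z - {q}"
      by blast
    then show "\<not> opposite (lsum g d i) (lsum g e' i)"
    proof cases
      case 1
      then show ?thesis
        using d(2) e'(2) gq by (simp add: lsum_def opposite_def)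
    next
      case 2
      then show ?thesis
        using supp[OF g(1)] supp[OF d(1)] by (simp add: lsum_def opposite_def)
    next
      case 3
      then have gi: "g i = TPos 0"
        using g(2) by blast
      have small_or: "lsum g x i = TPos 0 \<or> lsum g x i = x i \<and> 0 < tnorm (x i)" for x
        using gi by (auto simp: lsum_def left_sum_def zero_ereal_def)
      show ?thesis
      proof
        assume opp: "opposite (lsum g d i) (lsum g e' i)"
        have "lsum g d i \<noteq> TPos 0"
          using opp small_or[of e'] by (auto simp: opposite_def dest: sym[of _ "e' i"])
        then have dd: "lsum g d i = d i" "0 < tnorm (d i)"
          using small_or[of d] by blast+
        then have "lsum g e' i = e' i" "0 < tnorm (e' i)"
          using opp small_or[of e'] by (auto simp: opposite_def)
        then have opp': "opposite (d i) (e' i)" "0 < tnorm (e' i)"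
          using opp dd by simp_all
        \<comment> \<open>An entry taken from \<open>d\<close> cannot oppose \<open>d i\<close>, so
          this one comes from \<open>e\<close>. Neither \<open>d i\<close> nor \<open>e i\<close> is
          small, so both lie on side \<open>\<tau> i\<close>, where no two entries are
          opposite.\<close>
        then have ei: "e' i = TPos (p - p') * e i"
          using left_sum_cases[of "TPos (p - p') * e i" "d i"]
          by (auto simp: e'_def lsum_def scale_def opposite_def)
        have "\<not> tnorm (e i) \<le> 0"
          using opp'(2) p tnorm_scale_le[of "p - p'" "e i"] unfolding ei by (meson diff_le_0_iff_le not_le)
        then have "sided (\<tau> i) (e' i)" "sided (\<tau> i) (d i)"
          using R[of i] i 3 dd ei by (auto simp: sided_or_small_def)
        then show False
          using opp'(1) sided_not_opposite by blast
      qed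
    qed
  qed
  show "f q = TPos 0"
    using w d(2) e'(2) gq by (simp add: f_def lsum_def) (simp add: left_sum_def)
  show "tnorm (f w) \<le> 0"
    by (simp add: f_def)
  have fi: "f i = left_sum (left_sum (g i) (d i)) (left_sum (g i) (left_sum (TPos (p - p') * e i) (d i)))"
    if "i \<noteq> w" for i
    using that by (simp add: f_def e'_def lsum_def scale_def)
  show "sided_or_small (\<tau> i) (f i)" if "i \<noteq> q" for i
  proof (cases "i = w")
    case True
    then show ?thesis by (simp add: f_def sided_or_small_def)
  next
    case False
    have "sided_or_small (\<tau> i) (g i)"
      using small[OF that] by (simp add: sided_or_small_def)
    with R[OF that False] p show ?thesis
      unfolding fi[OF False] by (intro sided_or_small_left_sum sided_or_small_scale) auto
  qed
  show "tnorm (f i) \<le> 0" if "i \<noteq> q" "tnorm (d i) \<le> 0" "tnorm (e i) \<le> 0" for i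
  proof (cases "i = w")
    case True
    then show ?thesis by (simp add: f_def)
  next
    case False
    then show ?thesis
      using small[OF that(1)] that p tnorm_scale_le[of "p - p'" "e i"]
      by (simp add: fi tnorm_left_sum)
  qed
qed

lemma tc_cone_insert_zero:
  assumes C: "tc_cone C"
  shows "tc_cone (insert (\<lambda>_. TZero) C)"
proof -
  have "signed_vec (\<lambda>_. TZero)"
    by (simp add: signed_vec_def signed_trop_iff)
  then show ?thesis
    using C unfolding tc_cone_def by auto
qed

text \<open>Adding a threshold vector may lead out of the cone, but only through entries of norm at
  most the threshold. Recording a nearby \<open>c\<close> of \<open>C\<close> allows a return to
  \<open>C\<close>, and exact agreement at \<open>q\<close> preserves the positive entry of the
  certificate. Bounding both norms makes the relation stable under left sums: above the threshold
  both sides see the same entries.\<close>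

lemma pair_cone_truncated:
  assumes C: "tc_cone C"
  shows "pair_cone {(x, t). signed_vec x \<and>
    (\<exists>c\<in>C. \<forall>i. c i = x i \<or> i \<noteq> q \<and> tnorm (c i) \<le> t \<and> tnorm (x i) \<le> t)}"
  unfolding pair_cone_def
proof (intro conjI allI impI; clarsimp simp only: mem_Collect_eq case_prod_conv)
  fix x t r c
  assume "signed_vec x" "c \<in> C" "\<forall>i. c i = x i \<or> i \<noteq> q \<and> tnorm (c i) \<le> t \<and> tnorm (x i) \<le> t"
  moreover have "scale r c i = scale r x i \<or>
      i \<noteq> q \<and> tnorm (scale r c i) \<le> t + ereal r \<and> tnorm (scale r x i) \<le> t + ereal r" for i
    using calculation(3)[rule_format, of i] unfolding scale_def tnorm_times_TPos
    by (metis add_right_mono)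
  ultimately show "signed_vec (scale r x) \<and> (\<exists>c\<in>C. \<forall>i. c i = scale r x i \<or>
      i \<noteq> q \<and> tnorm (c i) \<le> t + ereal r \<and> tnorm (scale r x i) \<le> t + ereal r)"
    using tc_coneD(2)[OF C] signed_vec_scale by blast
next
  fix x t y u c c'
  assume "signed_vec x" "c \<in> C" and c: "\<forall>i. c i = x i \<or> i \<noteq> q \<and> tnorm (c i) \<le> t \<and> tnorm (x i) \<le> t"
    and "signed_vec y" "c' \<in> C" and c': "\<forall>i. c' i = y i \<or> i \<noteq> q \<and> tnorm (c' i) \<le> u \<and> tnorm (y i) \<le> u"
  moreover have "lsum c c' i = lsum x y i \<or>
      i \<noteq> q \<and> tnorm (lsum c c' i) \<le> max t u \<and> tnorm (lsum x y i) \<le> max t u" for i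
    using c[rule_format, of i] c'[rule_format, of i] left_sum_truncated[of "c i" "x i" t "c' i" "y i" u]
    unfolding lsum_def by metis
  ultimately show "signed_vec (lsum x y) \<and> (\<exists>c\<in>C. \<forall>i. c i = lsum x y i \<or>
      i \<noteq> q \<and> tnorm (c i) \<le> max t u \<and> tnorm (lsum x y i) \<le> max t u)"
    using tc_coneD(3)[OF C] signed_vec_lsum by blast
qed

lemma sided_or_small_cases:
  assumes "sided_or_small s a" "a \<in> signed_trop"
  obtains "tnorm a \<le> 0" | p where "0 < p" "a = signed_real s p"
  using assms by (cases a; cases s) (force simp: sided_or_small_def sided_def signed_trop_iff)+

text \<open>One looks for \<open>b\<close> with \<open>b q = TPos 0\<close> and all other coefficients of norm \<open>< 0\<close>, the bounds being the
  threshold vectors \<open>(e i, 0)\<close>. If this fails for every sign pattern \<open>\<tau>\<close> of \<open>b\<close>, the vectors of \<open>C\<close>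
  obtained for the various \<open>\<tau>\<close> are merged one coordinate at a time.\<close>

lemma indicator_or_separated_if_dominated:
  fixes C :: "('n::finite \<Rightarrow> symtrop) set"
  assumes C: "tc_cone C" and support: "\<forall>x\<in>C. \<forall>i. i \<notin> Z \<longrightarrow> x i = TZero" and q: "q \<in> Z"
    and g: "g \<in> C" "\<forall>i\<in>Z - {q}. g i = TPos 0" "tnorm (g q) < 0"
    and X: "finite X" "X \<subseteq> C"
  shows "indicator_vec Z \<in> C \<or> separated X Z"
proof (rule disjCI)
  have supp: "x i = TZero" if "x \<in> C" "i \<notin> Z" for x i
    using support that by blast
  assume nsep: "\<not> separated X Z"
  have orthant: "\<exists>c\<in>C. c q = TPos 0 \<and> (\<forall>i. i \<noteq> q \<longrightarrow> sided_or_small (\<tau> i) (c i))" for \<tau>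
  proof -
    \<comment> \<open>A threshold vector is small everywhere, so it is approximated by the zero
      vector, which \<open>C\<close> need not contain.\<close>
    define C0 where "C0 = insert (\<lambda>_. TZero) C"
    define D where "D = {(x, t). signed_vec x \<and>
      (\<exists>c\<in>C0. \<forall>i. c i = x i \<or> i \<noteq> q \<and> tnorm (c i) \<le> t \<and> tnorm (x i) \<le> t)}"
    \<comment> \<open>The only product of \<open>b\<close> with \<open>e i\<close> that can be
      nonzero is \<open>b i * TNeg 0\<close>, so threshold 0 excludes exactly
      \<open>b i = TNeg n\<close> with \<open>n \<ge> 0\<close>. This is the strict bound in
      \<open>separated\<close> for \<open>b q = TPos 0\<close>.\<close>
    define e where "e i = (\<lambda>j. if j = i then TNeg 0 else TZero)" for i :: 'n
    define Y :: "(('n \<Rightarrow> symtrop) \<times> ereal) set" where "Y = X \<times> {-\<infinity>} \<union> (\<lambda>i. (e i, 0)) ` (Z - {q})"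
    have D: "pair_cone D"
      unfolding D_def C0_def by (intro pair_cone_truncated tc_cone_insert_zero C)
    have finY: "finite Y"
      using X by (simp add: Y_def)
    have "(x, -\<infinity>) \<in> D" if "x \<in> X" for x
      using that X tc_coneD(1)[OF C] by (auto simp: D_def C0_def)
    moreover have "(e i, 0) \<in> D" if "i \<in> Z - {q}" for i
      using that by (auto simp: D_def C0_def e_def signed_vec_def signed_trop_iff)
    ultimately have YD: "Y \<subseteq> D"
      by (auto simp: Y_def)
    have "\<not> (\<exists>b. signed_vec b \<and> b q = TPos 0 \<and> (\<forall>i. i \<notin> insert q (Z - {q}) \<longrightarrow> b i = TZero) \<and>
      (\<forall>(x, t)\<in>Y. sat b x t))"
    proof
      assume "\<exists>b. signed_vec b \<and> b q = TPos 0 \<and> (\<forall>i. i \<notin> insert q (Z - {q}) \<longrightarrow> b i = TZero) \<and>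
        (\<forall>(x, t)\<in>Y. sat b x t)"
      then obtain b where b: "signed_vec b" "b q = TPos 0" "\<forall>(x, t)\<in>Y. sat b x t"
        by blast
      have "n < 0" if j: "j \<in> Z" "b j = TNeg n" for j n
      proof -
        have "j \<in> Z - {q}"
          using j b(2) by auto
        then have s: "sat b (e j) 0"
          using b(3) by (auto simp: Y_def)
        have "b j * e j j = TPos n"
          using j by (simp add: e_def)
        moreover have "b i * e j i \<noteq> TNeg m" for i m
          using j by (cases "i = j") (simp_all add: e_def)
        ultimately have "ereal n < 0"
          using s unfolding sat_def by blast
        then show ?thesis
          by simp
      qed
      moreover have "\<forall>x\<in>X. sat b x (-\<infinity>)"
        using b(3) by (auto simp: Y_def)
      ultimately have "separated X Z"
        unfolding separated_def using b(1,2) q by blast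
      with nsep show False ..
    qed
    then obtain x t p where x: "(x, t) \<in> D" "x q = TPos p" "t \<le> ereal p" "\<forall>i\<in>Z - {q}. sided (\<tau> i) (x i)"
      using fourier_motzkin_iterated[OF _ _ D finY YD, of "Z - {q}" q \<tau>] by auto
    then obtain c where c: "c \<in> C0" "\<And>i. c i = x i \<or> i \<noteq> q \<and> tnorm (c i) \<le> t \<and> tnorm (x i) \<le> t"
      unfolding D_def by blast
    have cq: "c q = TPos p"
      using c(2)[of q] x(2) by simp
    with c(1) have cC: "c \<in> C"
      by (auto simp: C0_def)
    have "sided_or_small (\<tau> i) (scale (- p) c i)" if "i \<noteq> q" for i
    proof (cases "i \<in> Z")
      case False
      then show ?thesis
        using supp[OF cC] by (simp add: scale_def sided_or_small_def)
    next
      case True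
      consider "c i = x i" | "tnorm (c i) \<le> ereal p"
        using c(2)[of i] x(3) by (meson order.trans)
      then show ?thesis
      proof cases
        case 1
        then show ?thesis
          using x(4) True that by (simp add: scale_def sided_or_small_def)
      next
        case 2
        then show ?thesis
          by (cases "c i") (auto simp: scale_def sided_or_small_def)
      qed
    qed
    moreover have "scale (- p) c q = TPos 0"
      by (simp add: scale_def cq)
    ultimately show ?thesis
      using tc_coneD(2)[OF C cC] by blast
  qed
  \<comment> \<open>The pattern stays arbitrary because the step at \<open>w\<close> needs both
    signs. If neither of the two vectors is small at \<open>w\<close>, they have opposite signs
    there, and the one of smaller norm plays \<open>d\<close> in
    \<open>merge_coordinate\<close>.\<close>
  have boxed: "\<exists>c\<in>C. c q = TPos 0 \<and> (\<forall>i\<in>K. tnorm (c i) \<le> 0) \<and>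
      (\<forall>i. i \<noteq> q \<longrightarrow> sided_or_small (\<tau> i) (c i))" if "finite K" "q \<notin> K" for K \<tau>
    using that
  proof (induction K arbitrary: \<tau> rule: finite_induct)
    case empty
    then show ?case
      using orthant[of \<tau>] by simp
  next
    case (insert w K)
    have w: "w \<noteq> q" "q \<notin> K"
      using insert.prems by auto
    obtain c where c: "c \<in> C" "c q = TPos 0" "\<And>i. i \<in> K \<Longrightarrow> tnorm (c i) \<le> 0"
        "\<And>i. i \<noteq> q \<Longrightarrow> sided_or_small ((\<tau>(w := True)) i) (c i)"
      using insert.IH[OF w(2), of "\<tau>(w := True)"] by blast
    obtain d where d: "d \<in> C" "d q = TPos 0" "\<And>i. i \<in> K \<Longrightarrow> tnorm (d i) \<le> 0"
        "\<And>i. i \<noteq> q \<Longrightarrow> sided_or_small ((\<tau>(w := False)) i) (d i)"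
      using insert.IH[OF w(2), of "\<tau>(w := False)"] by blast
    have resolved: ?case if "f \<in> C" "f q = TPos 0" "tnorm (f w) \<le> 0" "\<And>i. i \<in> K \<Longrightarrow> tnorm (f i) \<le> 0"
        "\<And>i. i \<noteq> q \<Longrightarrow> i \<noteq> w \<Longrightarrow> sided_or_small (\<tau> i) (f i)" for f
      using that by (intro bexI[of _ f]) (auto simp: sided_or_small_def)
    have side: "sided_or_small (\<tau> i) (c i) \<and> sided_or_small (\<tau> i) (d i)"
        "sided_or_small (\<tau> i) (d i) \<and> sided_or_small (\<tau> i) (c i)" if "i \<noteq> q" "i \<noteq> w" for i
      using that c(4)[of i] d(4)[of i] by auto
    consider "tnorm (c w) \<le> 0" | "tnorm (d w) \<le> 0"
      | p p' where "c w = TPos p" "d w = TNeg p'" "0 < p" "0 < p'"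
    proof -
      have "c w \<in> signed_trop" "d w \<in> signed_trop"
        using tc_coneD(1)[OF C] c(1) d(1) by (auto simp: signed_vec_def)
      with c(4)[OF w(1)] d(4)[OF w(1)] show thesis
        by (elim sided_or_small_cases) (use that in simp_all)
    qed
    then show ?case
    proof cases
      case 1
      then show ?thesis
        using c side by (intro resolved[of c]) auto
    next
      case 2
      then show ?thesis
        using d side by (intro resolved[of d]) auto
    next
      case (3 p p')
      show ?thesis
      proof (cases "p \<le> p'")
        case True
        obtain f where "f \<in> C" "f q = TPos 0" "tnorm (f w) \<le> 0"
          "\<And>i. i \<noteq> q \<Longrightarrow> sided_or_small (\<tau> i) (f i)"
          "\<And>i. i \<noteq> q \<Longrightarrow> tnorm (c i) \<le> 0 \<Longrightarrow> tnorm (d i) \<le> 0 \<Longrightarrow> tnorm (f i) \<le> 0"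
          by (rule merge_coordinate[where g = g and q = q and Z = Z and d = c and e = d and w = w
                and s = True and p = p and p' = p' and \<tau> = \<tau>, OF C support g]) (use 3 True c d w side(1) in auto)
        then show ?thesis
          using c(3) d(3) w by (intro resolved[of f]; metis)
      next
        case False
        obtain f where "f \<in> C" "f q = TPos 0" "tnorm (f w) \<le> 0"
          "\<And>i. i \<noteq> q \<Longrightarrow> sided_or_small (\<tau> i) (f i)"
          "\<And>i. i \<noteq> q \<Longrightarrow> tnorm (d i) \<le> 0 \<Longrightarrow> tnorm (c i) \<le> 0 \<Longrightarrow> tnorm (f i) \<le> 0"
          by (rule merge_coordinate[where g = g and q = q and Z = Z and d = d and e = c and w = w
                and s = False and p = p' and p' = p and \<tau> = \<tau>, OF C support g]) (use 3 False c d w side(2) in auto)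
        then show ?thesis
          using c(3) d(3) w by (intro resolved[of f]; metis)
      qed
    qed
  qed
  have "finite (Z - {q})" "q \<notin> Z - {q}"
    by simp_all
  from boxed[OF this] obtain c where c: "c \<in> C" "c q = TPos 0" "\<And>i. i \<in> Z - {q} \<Longrightarrow> tnorm (c i) \<le> 0"
    by blast
  have "lsum g c i = indicator_vec Z i" for i
  proof -
    consider "i = q" | "i \<notin> Z" | "i \<in> Z - {q}"
      by blast
    then show ?thesis
    proof cases
      case 1
      then show ?thesis
        using c(2) g(3) q leD by (auto simp: lsum_def indicator_vec_def left_sum_def zero_ereal_def)
    next
      case 2
      then show ?thesis
        using supp[OF g(1)] supp[OF c(1)] by (simp add: lsum_def indicator_vec_def)
    next
      case 3
      then show ?thesis
        using bspec[OF g(2) 3] c(3)[OF 3] by (simp add: lsum_def indicator_vec_def left_sum_def zero_ereal_def)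
    qed
  qed
  then have "lsum g c = indicator_vec Z" ..
  then show "indicator_vec Z \<in> C"
    using tc_coneD(3)[OF C g(1) c(1)] by simp
qed

subsection \<open>Separating an indicator vector from a cone\<close>

text \<open>The vectors among which conditions remain after a coefficient of sign \<open>s\<close>
  at \<open>w\<close> is eliminated, with that coordinate deleted.\<close>

definition face :: "bool \<Rightarrow> 'n \<Rightarrow> ('n \<Rightarrow> symtrop) set \<Rightarrow> ('n \<Rightarrow> symtrop) set" where
  "face s w C = (\<lambda>x. x(w := TZero)) ` {x \<in> C. sided s (x w)}"

lemma scale_upd_zero: "scale r (x(w := TZero)) = (scale r x)(w := TZero)"
  by (auto simp: scale_def)

lemma lsum_upd_zero: "lsum (x(w := TZero)) (y(w := TZero)) = (lsum x y)(w := TZero)"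
  by (auto simp: lsum_def)

text \<open>Two vectors on the same side at \<open>w\<close> never cancel there, so an elimination
  permitted after deleting \<open>w\<close> is already permitted in \<open>C\<close>.\<close>

lemma tc_cone_face:
  assumes C: "tc_cone C"
  shows "tc_cone (face s w C)"
proof -
  have "(lsum x y)(w := TZero, v := TZero) \<in> face s w C"
    if x: "x \<in> C" "sided s (x w)" and y: "y \<in> C" "sided s (y w)"
      and opp: "opposite ((x(w := TZero)) v) ((y(w := TZero)) v)"
      and no: "\<And>i. i \<noteq> v \<Longrightarrow> \<not> opposite ((x(w := TZero)) i) ((y(w := TZero)) i)" for x y v
  proof -
    have v: "v \<noteq> w"
      using opp by auto
    have "(lsum x y)(v := TZero) \<in> C"
    proof (rule tc_coneD(4)[OF C x(1) y(1)])
      show "opposite (x v) (y v)"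
        using opp v by simp
      fix i assume "i \<noteq> v"
      then show "\<not> opposite (x i) (y i)"
        using no[of i] sided_not_opposite[OF x(2) y(2)] by (cases "i = w") auto
    qed
    moreover have "sided s (((lsum x y)(v := TZero)) w)"
      using v x y by (simp add: lsum_def sided_left_sum)
    ultimately show ?thesis
      unfolding face_def using v by (metis (mono_tags, lifting) fun_upd_twist image_eqI mem_Collect_eq)
  qed
  moreover have "signed_vec (x(w := TZero))" if "x \<in> C" for x
    using tc_coneD(1)[OF C that] by (simp add: signed_vec_def signed_trop_iff)
  moreover have "(scale r x)(w := TZero) \<in> face s w C" if "x \<in> C" "sided s (x w)" for r x
    using tc_coneD(2)[OF C that(1), of r] that(2) by (auto simp: face_def scale_def)
  moreover have "(lsum x y)(w := TZero) \<in> face s w C"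
    if "x \<in> C" "sided s (x w)" "y \<in> C" "sided s (y w)" for x y
    using tc_coneD(3)[OF C that(1,3)] that(2,4) by (auto simp: face_def lsum_def sided_left_sum)
  ultimately show ?thesis
    unfolding tc_cone_def face_def
    by (simp only: ball_simps mem_Collect_eq lsum_upd_zero scale_upd_zero) blast
qed

lemma sat_cong: "(\<And>i. b i * x i = b' i * x' i) \<Longrightarrow> sat b x t \<longleftrightarrow> sat b' x' t"
  by (simp add: sat_def)

text \<open>Lifts a separation through the elimination of \<open>w\<close>. For
  \<open>s = True\<close> the new coefficient is not negative, so \<open>w\<close> may join
  \<open>Z\<close> without disturbing strict positivity on the indicator vector.\<close>

lemma separated_from_face:
  fixes C :: "('n::finite \<Rightarrow> symtrop) set"
  assumes C: "tc_cone C" and X: "finite X" "X \<subseteq> C"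
  obtains X' where "finite X'" "X' \<subseteq> face s w C"
    "\<And>Z. w \<notin> Z \<Longrightarrow> separated X' Z \<Longrightarrow> separated X Z"
    "\<And>Z. s \<Longrightarrow> w \<notin> Z \<Longrightarrow> separated X' Z \<Longrightarrow> separated X (insert w Z)"
proof -
  define D :: "(('n \<Rightarrow> symtrop) \<times> ereal) set" where "D = C \<times> {-\<infinity>}"
  have D: "pair_cone D"
    using tc_coneD[OF C] by (simp add: D_def pair_cone_def)
  have Y0: "finite (X \<times> {- \<infinity> :: ereal})" "X \<times> {-\<infinity>} \<subseteq> D"
    using X by (auto simp: D_def)
  obtain Y where Y: "finite Y" "Y \<subseteq> {(x, t) \<in> D. sided s (x w)}"
    and ext: "\<And>b. b w = TZero \<Longrightarrow> \<forall>(x, t)\<in>Y. sat b x t \<Longrightarrow>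
      \<exists>a\<in>signed_trop. sided s a \<and> (\<forall>(x, t)\<in>X \<times> {-\<infinity>}. sat (b(w := a)) x t)"
    by (rule fourier_motzkin[OF D Y0, where s = s and w = w]) blast
  define X' where "X' = (\<lambda>(x, t). x(w := TZero)) ` Y"
  have extend: "\<exists>a. sided s a \<and> signed_vec (b(w := a)) \<and> (\<forall>x\<in>X. sat (b(w := a)) x (-\<infinity>))"
    if b: "signed_vec b" "\<forall>x\<in>X'. sat b x (-\<infinity>)" for b
  proof -
    have "sat (b(w := TZero)) x t" if "(x, t) \<in> Y" for x t
    proof -
      have "t = -\<infinity>" "sat b (x(w := TZero)) (-\<infinity>)"
        using that Y b by (auto simp: X'_def D_def)
      moreover have "sat b (x(w := TZero)) t \<longleftrightarrow> sat (b(w := TZero)) x t"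
        by (intro sat_cong) simp
      ultimately show ?thesis
        by simp
    qed
    then obtain a where "a \<in> signed_trop" "sided s a"
      "\<forall>(x, t)\<in>X \<times> {-\<infinity>}. sat (b(w := TZero, w := a)) x t"
      using ext[of "b(w := TZero)"] by auto
    then show ?thesis
      using signed_vec_upd[OF b(1)] by auto
  qed
  show ?thesis
  proof
    show "finite X'"
      using Y by (simp add: X'_def)
    show "X' \<subseteq> face s w C"
      using Y by (auto simp: X'_def D_def face_def)
    fix Z assume w: "w \<notin> Z" and "separated X' Z"
    then obtain b q p where b: "signed_vec b" "\<forall>x\<in>X'. sat b x (-\<infinity>)" "q \<in> Z" "b q = TPos p"
        "\<forall>j\<in>Z. \<forall>n. b j = TNeg n \<longrightarrow> n < p"
      unfolding separated_def by blast
    from extend[OF b(1,2)] obtain a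
      where a: "sided s a" "signed_vec (b(w := a))" "\<forall>x\<in>X. sat (b(w := a)) x (-\<infinity>)"
      by blast
    have "(b(w := a)) q = TPos p" "\<forall>j\<in>Z. \<forall>n. (b(w := a)) j = TNeg n \<longrightarrow> n < p"
      using b w by auto
    with a b(3) show "separated X Z"
      unfolding separated_def by blast
    assume s
    have "(b(w := a)) q = TPos p" "\<forall>j\<in>insert w Z. \<forall>n. (b(w := a)) j = TNeg n \<longrightarrow> n < p"
      using b w a(1) \<open>s\<close> by (auto simp: sided_def)
    with a b(3) show "separated X (insert w Z)"
      unfolding separated_def by blast
  qed
qed

lemma merge_indicator:
  assumes C: "tc_cone C" and d: "d \<in> C" "d(w := TZero) = indicator_vec Z" "d w = signed_real s p"
    and e: "e \<in> C" "e(w := TZero) = indicator_vec Z" "e w = signed_real (\<not> s) p'"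
    and w: "w \<notin> Z" and p: "p \<le> p'"
  shows "indicator_vec Z \<in> C"
proof -
  have v: "d i = indicator_vec Z i" "e i = indicator_vec Z i" if "i \<noteq> w" for i
    using that d(2) e(2) by (metis fun_upd_other)+
  \<comment> \<open>As in \<open>merge_coordinate\<close>: after scaling, the entries at
    \<open>w\<close> tie, and \<open>d\<close> restores the entries on \<open>Z\<close>.\<close>
  define e' where "e' = lsum (scale (p - p') e) d"
  have e': "e' \<in> C"
    unfolding e'_def using tc_coneD[OF C] d(1) e(1) by blast
  have e'i: "e' i = indicator_vec Z i" if "i \<noteq> w" for i
    using that p by (auto simp: e'_def lsum_def scale_def v indicator_vec_def left_sum_def)
  have e'w: "e' w = signed_real (\<not> s) p"
    using d(3) e(3) by (auto simp: e'_def lsum_def scale_def left_sum_def)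
  have "(lsum d e')(w := TZero) \<in> C"
    using d(3) e'w e'i v(1)
    by (intro tc_coneD(4)[OF C d(1) e']) (auto simp: opposite_def)
  moreover have "(lsum d e')(w := TZero) = indicator_vec Z"
    using e'i v(1) w by (auto simp: lsum_def left_sum_def indicator_vec_def)
  ultimately show ?thesis
    by simp
qed

lemma indicator_of_two_faces:
  assumes C: "tc_cone C" and "indicator_vec Z \<in> face True w C" "indicator_vec Z \<in> face False w C"
    and w: "w \<notin> Z"
  shows "indicator_vec Z \<in> C"
proof -
  obtain d where d: "d \<in> C" "sided True (d w)" "d(w := TZero) = indicator_vec Z"
    using assms(2) by (auto simp: face_def)
  obtain e where e: "e \<in> C" "sided False (e w)" "e(w := TZero) = indicator_vec Z"
    using assms(3) by (auto simp: face_def)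
  have "d w \<in> signed_trop" "e w \<in> signed_trop"
    using tc_coneD(1)[OF C] d(1) e(1) by (auto simp: signed_vec_def)
  then consider "d w = TZero" | "e w = TZero" | p p' where "d w = TPos p" "e w = TNeg p'"
    using d(2) e(2) by (cases "d w"; cases "e w") (auto simp: sided_def signed_trop_iff)
  then show ?thesis
  proof cases
    case 1
    then show ?thesis using d by (metis fun_upd_triv)
  next
    case 2
    then show ?thesis using e by (metis fun_upd_triv)
  next
    case (3 p p')
    then show ?thesis
      using merge_indicator[OF C d(1,3) _ e(1,3) _ w, of True p p']
        merge_indicator[OF C e(1,3) _ d(1,3) _ w, of False p' p] by simp linarith
  qed
qed

text \<open>On positive entries the left sum is the maximum, so it suffices that each coordinate of
  \<open>Z\<close> reaches level 0 in one of the vectors.\<close>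

lemma indicator_by_covering:
  fixes C :: "('n::finite \<Rightarrow> symtrop) set"
  assumes C: "tc_cone C" and support: "\<forall>x\<in>C. \<forall>i. i \<notin> Z \<longrightarrow> x i = TZero" and "Z \<noteq> {}"
    and h: "\<And>w. w \<in> Z \<Longrightarrow> \<exists>h\<in>C. h w = TPos 0 \<and> (\<forall>i\<in>Z. \<exists>m\<le>0. h i = TPos m)"
  shows "indicator_vec Z \<in> C"
proof -
  have "\<exists>h\<in>C. (\<forall>i\<in>Q. h i = TPos 0) \<and> (\<forall>i\<in>Z. \<exists>m\<le>0. h i = TPos m)"
    if "finite Q" "Q \<noteq> {}" "Q \<subseteq> Z" for Q
    using that
  proof (induction Q rule: finite_ne_induct)
    case (singleton w)
    then show ?case using h by simp
  next
    case (insert w Q)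
    then obtain x where x: "x \<in> C" "\<forall>i\<in>Q. x i = TPos 0" "\<forall>i\<in>Z. \<exists>m\<le>0. x i = TPos m"
      by blast
    obtain y where y: "y \<in> C" "y w = TPos 0" "\<forall>i\<in>Z. \<exists>m\<le>0. y i = TPos m"
      using h insert.prems by blast
    have "\<exists>m\<le>0. lsum x y i = TPos m \<and> (i \<in> insert w Q \<longrightarrow> m = 0)" if "i \<in> Z" for i
      using bspec[OF x(3) that] bspec[OF y(3) that] x(2) y(2)
      by (auto simp: lsum_def left_sum_def)
    with insert.prems tc_coneD(3)[OF C x(1) y(1)] show ?case
      by (intro bexI[of _ "lsum x y"]) force+
  qed
  from this[of Z] \<open>Z \<noteq> {}\<close> obtain x where x: "x \<in> C" "\<forall>i\<in>Z. x i = TPos 0"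
    by auto
  have "x = indicator_vec Z"
    using x support by (auto simp: indicator_vec_def)
  with x show ?thesis by simp
qed

text \<open>The induction is on the support bound \<open>A\<close>, which shrinks with every
  deletion. A coordinate outside \<open>Z\<close> is deleted on both sides and the two resulting
  vectors are merged; a coordinate of \<open>Z\<close> is deleted only on side \<open>True\<close>,
  from which separations lift back to \<open>Z\<close>.\<close>

lemma indicator_or_separated:
  fixes C :: "('n::finite \<Rightarrow> symtrop) set"
  assumes "tc_cone C" "\<forall>x\<in>C. \<forall>i. i \<notin> A \<longrightarrow> x i = TZero" "Z \<subseteq> A" "Z \<noteq> {}" "finite X" "X \<subseteq> C"
  shows "indicator_vec Z \<in> C \<or> separated X Z"
  using assms
proof (induction "card A" arbitrary: A C X Z rule: less_induct)
  case less
  note C = less.prems(1) and support = less.prems(2) and Z = less.prems(3,4) and X = less.prems(5,6)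
  have faces: "indicator_vec Z' \<in> face s w C \<or> separated X' Z'"
    if "w \<in> A" "Z' \<subseteq> A - {w}" "Z' \<noteq> {}" "finite X'" "X' \<subseteq> face s w C" for s w Z' X'
  proof (rule less.hyps[of "A - {w}"])
    show "card (A - {w}) < card A"
      using that(1) by (intro psubset_card_mono) auto
    show "\<forall>x\<in>face s w C. \<forall>i. i \<notin> A - {w} \<longrightarrow> x i = TZero"
      using support by (auto simp: face_def)
  qed (use that tc_cone_face[OF C] in auto)
  show ?case
  proof (cases "A = Z")
    case False
    then obtain w where w: "w \<in> A" "w \<notin> Z"
      using Z by blast
    have "separated X Z \<or> indicator_vec Z \<in> face s w C" for s
    proof -
      obtain X' where X': "finite X'" "X' \<subseteq> face s w C" "separated X' Z \<Longrightarrow> separated X Z"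
        using separated_from_face[OF C X, of s w] w(2) by metis
      have "Z \<subseteq> A - {w}"
        using Z w by blast
      with faces[OF w(1) this Z(2) X'(1,2)] X'(3) show ?thesis
        by blast
    qed
    then show ?thesis
      using indicator_of_two_faces[OF C _ _ w(2)] by blast
  next
    case True
    note support = support[unfolded True]
    show ?thesis
    proof (cases "\<exists>q. Z = {q}")
      case True
      then obtain q where q: "Z = {q}"
        by blast
      show ?thesis
      proof (cases "\<exists>x\<in>X. \<exists>p. x q = TPos p")
        case True
        then obtain x p where x: "x \<in> X" "x q = TPos p"
          by blast
        then have xC: "x \<in> C"
          using X by blast
        have "scale (- p) x i = indicator_vec Z i" for i
          using support xC q x(2) by (cases "i = q") (auto simp: scale_def indicator_vec_def)
        then have "scale (- p) x = indicator_vec Z" ..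
        then show ?thesis
          using tc_coneD(2)[OF C xC, of "- p"] by simp
      next
        case False
        have "indicator_vec Z i * x i \<noteq> TPos p" if "x \<in> X" for x i p
          using False that q by (cases "x i") (auto simp: indicator_vec_def)
        then have "\<forall>x\<in>X. sat (indicator_vec Z) x (-\<infinity>)"
          by (simp add: sat_def)
        then have "separated X Z"
          unfolding separated_def using q
          by (intro exI[of _ "indicator_vec Z"])
            (auto simp: signed_vec_def signed_trop_iff indicator_vec_def)
        then show ?thesis ..
      qed
    next
      case False
      have near: "\<exists>x\<in>C. sided True (x w) \<and> x(w := TZero) = indicator_vec (Z - {w})"
        if nsep: "\<not> separated X Z" and w: "w \<in> Z" for w
      proof -
        obtain X' where X': "finite X'" "X' \<subseteq> face True w C"
          "separated X' (Z - {w}) \<Longrightarrow> separated X (insert w (Z - {w}))"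
          using separated_from_face[OF C X, of True w] by (metis DiffD2 insertI1)
        have "\<not> separated X' (Z - {w})"
          using X'(3) nsep w by (auto simp: insert_absorb)
        moreover have "Z - {w} \<subseteq> A - {w}" "Z - {w} \<noteq> {}" "w \<in> A"
          using False w Z by auto
        ultimately have "indicator_vec (Z - {w}) \<in> face True w C"
          using faces X'(1,2) by blast
        then show ?thesis
          by (auto simp: face_def)
      qed
      show ?thesis
      proof (cases "separated X Z")
        case nsep: False
        have "indicator_vec Z \<in> C"
        \<comment> \<open>Either some vector lies below the level at its exceptional coordinate and
          serves as \<open>g\<close>, or those from \<open>near\<close> are at least 0 there. Scaled
          to \<open>TPos 0\<close> at \<open>w\<close>, their other entries on \<open>Z\<close> drop
          to at most 0.\<close>
        proof (cases "\<exists>w\<in>Z. \<exists>x\<in>C. x(w := TZero) = indicator_vec (Z - {w}) \<and> tnorm (x w) < 0")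
          case True
          then obtain w x where x: "w \<in> Z" "x \<in> C" "x(w := TZero) = indicator_vec (Z - {w})" "tnorm (x w) < 0"
            by blast
          have "x i = TPos 0" if "i \<in> Z - {w}" for i
            using that fun_cong[OF x(3), of i] by (simp add: indicator_vec_def)
          then show ?thesis
            using indicator_or_separated_if_dominated[OF C support x(1,2) _ x(4) X] nsep by blast
        next
          case False
          show ?thesis
          proof (rule indicator_by_covering[OF C support Z(2)])
            fix w assume w: "w \<in> Z"
            from near[OF nsep w] obtain x
              where x: "x \<in> C" "sided True (x w)" "x(w := TZero) = indicator_vec (Z - {w})"
              by blast
            have "x w \<in> signed_trop"
              using tc_coneD(1)[OF C x(1)] by (simp add: signed_vec_def)
            moreover have "\<not> tnorm (x w) < 0"
              using False w x by blast
            ultimately obtain r where r: "x w = TPos r" "0 \<le> r"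
              using x(2) by (cases "x w") (auto simp: sided_def signed_trop_iff)
            have xi: "x i = TPos 0" if "i \<in> Z" "i \<noteq> w" for i
              using that fun_cong[OF x(3), of i] by (simp add: indicator_vec_def)
            have "\<exists>m\<le>0. scale (- r) x i = TPos m" if "i \<in> Z" for i
              using that r xi[of i] by (cases "i = w") (auto simp: scale_def)
            moreover have "scale (- r) x w = TPos 0"
              by (simp add: scale_def r)
            ultimately show "\<exists>h\<in>C. h w = TPos 0 \<and> (\<forall>i\<in>Z. \<exists>m\<le>0. h i = TPos m)"
              using tc_coneD(2)[OF C x(1)] by blast
          qed
        qed
        then show ?thesis ..
      qed simp
    qed
  qed
qed

section \<open>Change of coordinates and separation of arbitrary points\<close>

text \<open>Each \<open>g i\<close> is a unit of the semiring, and multiplication by a unit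
  preserves comparison of norms and cancellation.\<close>

lemma tc_cone_rescale:
  assumes C: "tc_cone C" and g: "\<And>i. \<exists>s r. g i = signed_real s r"
  shows "tc_cone ((\<lambda>x i. g i * x i) ` C)"
proof -
  have L: "left_sum (g i * a) (g i * b) = g i * left_sum a b"
    and O: "opposite (g i * a) (g i * b) \<longleftrightarrow> opposite a b" for i a b
  proof -
    obtain s r where "g i = signed_real s r"
      using g by blast
    then show "left_sum (g i * a) (g i * b) = g i * left_sum a b"
        "opposite (g i * a) (g i * b) \<longleftrightarrow> opposite a b"
      by (cases a; cases b; cases s; auto simp: left_sum_def opposite_def)+
  qed
  have S: "g i \<in> signed_trop" for i
    using g[of i] by (auto simp: signed_trop_iff split: if_splits)
  have 1: "signed_vec (\<lambda>i. g i * x i)" if "x \<in> C" for x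
    using tc_coneD(1)[OF C that] S by (simp add: signed_vec_def times_signed)
  have 2: "scale r (\<lambda>i. g i * x i) = (\<lambda>i. g i * scale r x i)" for r x
    by (simp add: scale_def mult.left_commute)
  have 3: "lsum (\<lambda>i. g i * x i) (\<lambda>i. g i * y i) = (\<lambda>i. g i * lsum x y i)" for x y
    by (simp add: lsum_def L)
  have 4: "(\<lambda>i. g i * x i)(v := TZero) = (\<lambda>i. g i * (x(v := TZero)) i)" for x v
    by auto
  show ?thesis
    using C 1 unfolding tc_cone_def ball_simps 2 3 4 O by blast
qed

text \<open>Rescaling and flipping the coordinates turns the target point into an indicator vector.\<close>

theorem tc_cone_separation:
  fixes C :: "('n::finite \<Rightarrow> symtrop) set"
  assumes C: "tc_cone C" and X: "finite X" "X \<subseteq> C"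
    and z: "signed_vec z" "z k \<noteq> TZero" "z \<notin> C"
  obtains b where "signed_vec b" "\<forall>x\<in>X. sat b x (-\<infinity>)" "\<not> sat b z (-\<infinity>)"
proof -
  \<comment> \<open>The inverse of \<open>z i\<close> where it exists, and the unit
    \<open>TPos 0\<close> where \<open>z i = TZero\<close>.\<close>
  define g where "g i = (case z i of TPos r \<Rightarrow> TPos (- r) | TNeg r \<Rightarrow> TNeg (- r) | _ \<Rightarrow> TPos 0)" for i
  have g: "\<exists>s r. g i = signed_real s r" for i
    by (cases "z i") (auto simp: g_def intro: exI[of _ True] exI[of _ False])
  have gS: "g i \<in> signed_trop" for i
    by (cases "z i") (auto simp: g_def signed_trop_iff)
  define Z where "Z = {i. z i \<noteq> TZero}"
  have gz: "g i * z i = indicator_vec Z i" for i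
    using z(1) by (cases "z i") (auto simp: g_def indicator_vec_def Z_def signed_vec_def signed_trop_iff)
  let ?G = "\<lambda>x i. g i * x i"
  have inj: "x = y" if "?G x = ?G y" for x y
  proof
    fix i
    obtain s r where "g i = signed_real s r"
      using g by blast
    then show "x i = y i"
      using fun_cong[OF that, of i] by (cases "x i"; cases "y i"; cases s) auto
  qed
  have "indicator_vec Z \<notin> ?G ` C"
  proof
    assume "indicator_vec Z \<in> ?G ` C"
    then obtain x where "x \<in> C" "?G x = indicator_vec Z"
      by auto
    then have "?G x = ?G z"
      using gz by auto
    then show False
      using inj \<open>x \<in> C\<close> z(3) by blast
  qed
  moreover have "tc_cone (?G ` C)"
    by (rule tc_cone_rescale[OF C]) (rule g)
  moreover have "Z \<noteq> {}" "finite (?G ` X)" "?G ` X \<subseteq> ?G ` C"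
    using z(2) X by (auto simp: Z_def)
  ultimately have "separated (?G ` X) Z"
    using indicator_or_separated[where A = UNIV and C = "?G ` C" and Z = Z and X = "?G ` X"] by blast
  then obtain b q p where b: "signed_vec b" "\<forall>x\<in>X. sat b (?G x) (-\<infinity>)" "q \<in> Z" "b q = TPos p"
      "\<forall>j\<in>Z. \<forall>n. b j = TNeg n \<longrightarrow> n < p"
    unfolding separated_def by auto
  define b' where "b' i = b i * g i" for i
  have sat_b': "sat b' x t \<longleftrightarrow> sat b (?G x) t" for x t
    by (rule sat_cong) (simp add: b'_def mult.assoc)
  have "\<not> sat b (?G z) (-\<infinity>)"
  proof
    assume s: "sat b (?G z) (-\<infinity>)"
    have "b q * (g q * z q) = TPos p"
      using b(3,4) by (simp add: gz indicator_vec_def)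
    from sat_minf[OF s this] obtain j n where "b j * (g j * z j) = TNeg n" "p \<le> n"
      by blast
    then have "j \<in> Z" "b j = TNeg n"
      by (cases "j \<in> Z"; cases "b j"; simp add: gz indicator_vec_def)+
    with b(5) \<open>p \<le> n\<close> show False
      by force
  qed
  then show ?thesis
    using b(1,2) gS by (intro that[of b']) (auto simp: sat_b' b'_def signed_vec_def times_signed)
qed

subsection \<open>Homogenization\<close>

lemma sum_positive_or_balanced_iff:
  assumes "finite I" "\<And>i. i \<in> I \<Longrightarrow> f i \<in> signed_trop"
  shows "sum f I \<in> positive_trop \<union> balanced_trop \<longleftrightarrow>
    (\<forall>i\<in>I. \<forall>n. f i = TNeg n \<longrightarrow> (\<exists>j\<in>I. \<exists>p. f j = TPos p \<and> n \<le> p))"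
proof -
  \<comment> \<open>Strengthened for the induction: the sign of the sum is witnessed by terms of
    exactly its norm, a balanced sum by terms of both signs. The last clause excludes a positive
    term that ties under a negative sum.\<close>
  have "(\<forall>i\<in>I. tnorm (f i) \<le> tnorm (sum f I)) \<and>
    (\<forall>r. (sum f I = TPos r \<or> sum f I = TBal r) \<longrightarrow> (\<exists>j\<in>I. f j = TPos r)) \<and>
    (\<forall>r. (sum f I = TNeg r \<or> sum f I = TBal r) \<longrightarrow> (\<exists>j\<in>I. f j = TNeg r)) \<and>
    (\<forall>r. sum f I = TNeg r \<longrightarrow> (\<forall>j\<in>I. f j \<noteq> TPos r))"
    using assms
  proof (induction I rule: finite_induct)
    case empty
    then show ?case by (simp add: zero_symtrop_def)
  next
    case (insert k I)
    have k: "f k \<in> signed_trop"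
      using insert.prems by simp
    define s where "s = sum f I"
    have IH: "\<forall>i\<in>I. tnorm (f i) \<le> tnorm s"
      "\<And>r. s = TPos r \<or> s = TBal r \<Longrightarrow> \<exists>j\<in>I. f j = TPos r"
      "\<And>r. s = TNeg r \<or> s = TBal r \<Longrightarrow> \<exists>j\<in>I. f j = TNeg r"
      "\<And>r. s = TNeg r \<Longrightarrow> \<forall>j\<in>I. f j \<noteq> TPos r"
      using insert.IH[OF insert.prems[OF insertI2]] unfolding s_def by blast+
    have n: "tnorm (f k + s) = max (tnorm (f k)) (tnorm s)"
      by (cases "f k"; cases s) (auto simp: plus_symtrop_def)
    have p: "f k + s = TPos r \<Longrightarrow> f k = TPos r \<or> s = TPos r"
      and m: "f k + s = TNeg r \<Longrightarrow> f k = TNeg r \<or> s = TNeg r"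
      and b: "f k + s = TBal r \<Longrightarrow> s = TBal r \<or> (f k = TPos r \<and> s = TNeg r) \<or> (f k = TNeg r \<and> s = TPos r)"
      and m': "f k + s = TNeg r \<Longrightarrow> f k \<noteq> TPos r \<and> (s = TNeg r \<or> tnorm s < ereal r)" for r
      using k by (cases "f k"; cases s; auto simp: plus_symtrop_def signed_trop_iff split: if_splits)+
    have "f j \<noteq> TPos r" if "f k + s = TNeg r" "j \<in> insert k I" for r j
      using m'[OF that(1)] IH(1,4) that(2) by force
    moreover have "\<exists>j\<in>insert k I. f j = TPos r" if "f k + s = TPos r \<or> f k + s = TBal r" for r
      using that p b IH(2) by blast
    moreover have "\<exists>j\<in>insert k I. f j = TNeg r" if "f k + s = TNeg r \<or> f k + s = TBal r" for r
      using that m b IH(3) by blast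
    moreover have "\<forall>i\<in>insert k I. tnorm (f i) \<le> tnorm (f k + s)"
      using IH(1) by (auto simp: n le_max_iff_disj)
    moreover have "sum f (insert k I) = f k + s"
      using insert.hyps by (simp add: s_def)
    ultimately show ?case
      by simp
  qed
  then have le: "\<And>i. i \<in> I \<Longrightarrow> tnorm (f i) \<le> tnorm (sum f I)"
    and P: "\<And>r. sum f I = TPos r \<or> sum f I = TBal r \<Longrightarrow> \<exists>j\<in>I. f j = TPos r"
    and N: "\<And>r. sum f I = TNeg r \<Longrightarrow> (\<exists>j\<in>I. f j = TNeg r) \<and> (\<forall>j\<in>I. f j \<noteq> TPos r)"
    by blast+
  show ?thesis
  proof (cases "sum f I")
    case TZero
    then show ?thesis
      using le by (force simp: balanced_trop_def zero_symtrop_def)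
  next
    case (TNeg r)
    then obtain j where j: "j \<in> I" "f j = TNeg r"
      using N by blast
    have "\<not> r \<le> p" if "i \<in> I" "f i = TPos p" for i p
      using le[OF that(1)] N[OF TNeg] that TNeg by force
    then have "\<not> (\<exists>i\<in>I. \<exists>p. f i = TPos p \<and> r \<le> p)"
      by blast
    with j have "\<not> (\<forall>i\<in>I. \<forall>n. f i = TNeg n \<longrightarrow> (\<exists>j\<in>I. \<exists>p. f j = TPos p \<and> n \<le> p))"
      by blast
    moreover have "sum f I \<notin> positive_trop \<union> balanced_trop"
      using TNeg by (auto simp: positive_trop_def balanced_trop_def zero_symtrop_def)
    ultimately show ?thesis
      by blast
  next
    case (TPos r)
    then obtain j where "j \<in> I" "f j = TPos r"
      using P by blast
    with TPos le show ?thesis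
      by (force simp: positive_trop_def)
  next
    case (TBal r)
    then obtain j where "j \<in> I" "f j = TPos r"
      using P by blast
    with TBal le show ?thesis
      by (force simp: balanced_trop_def)
  qed
qed

definition homogenize :: "symtrop ^ 'd \<Rightarrow> 'd option \<Rightarrow> symtrop" where
  "homogenize x = case_option (TPos 0) (\<lambda>i. x $ i)"

text \<open>Meaningful only if \<open>c None\<close> is positive.\<close>

definition dehomogenize :: "('d option \<Rightarrow> symtrop) \<Rightarrow> symtrop ^ 'd" where
  "dehomogenize c = (\<chi> i. TPos (- real_of_ereal (tnorm (c None))) * c (Some i))"

definition halfspace_normal :: "symtrop \<Rightarrow> symtrop ^ 'd \<Rightarrow> 'd option \<Rightarrow> symtrop" where
  "halfspace_normal a0 a = (\<lambda>j. TNeg 0 * case_option a0 (\<lambda>i. a $ i) j)"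

lemma signed_vec_homogenize: "signed_vec (homogenize x) \<longleftrightarrow> x \<in> signed_space"
  by (auto simp: signed_vec_def homogenize_def signed_space_def signed_trop_iff split: option.splits)

lemma dehomogenize_homogenize [simp]: "dehomogenize (homogenize x) = x"
proof -
  have "TPos 0 * a = a" for a
    by (cases a) auto
  then show ?thesis
    by (simp add: dehomogenize_def homogenize_def vec_eq_iff)
qed

lemma homogenize_dehomogenize:
  "c None = TPos r \<Longrightarrow> homogenize (dehomogenize c) = scale (- r) c"
  by (rule ext) (auto simp: homogenize_def dehomogenize_def scale_def split: option.splits)

lemma dehomogenize_scale:
  assumes "c None = TPos r'"
  shows "dehomogenize (scale r c) = dehomogenize c"
proof -
  have "TPos (- (r + r')) * (TPos r * a) = TPos (- r') * a" for a
    by (cases a) auto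
  with assms show ?thesis
    by (simp add: dehomogenize_def scale_def vec_eq_iff)
qed

lemma closed_halfspace_iff:
  assumes x: "x \<in> signed_space" and a: "a0 \<in> signed_trop" "a \<in> signed_space"
  shows "x \<in> closed_halfspace a0 a \<longleftrightarrow> sat (halfspace_normal a0 a) (homogenize x) (-\<infinity>)"
proof -
  let ?c = "case_option a0 (\<lambda>i. a $ i)"
  let ?f = "\<lambda>j. ?c j * homogenize x j"
  have "?c j \<in> signed_trop" for j
    using a by (cases j) (auto simp: signed_space_def)
  then have f: "?f j \<in> signed_trop" for j
    using x signed_vec_homogenize[of x] by (simp add: times_signed signed_vec_def)
  have n: "halfspace_normal a0 a j * homogenize x j = TPos p \<longleftrightarrow> ?f j = TNeg p"
    "halfspace_normal a0 a j * homogenize x j = TNeg p \<longleftrightarrow> ?f j = TPos p" for j p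
    by (cases "?c j"; cases "homogenize x j"; simp add: halfspace_normal_def)+
  have "a0 * TPos 0 = a0"
    by (cases a0) auto
  then have "a0 + (\<Sum>i\<in>UNIV. a $ i * x $ i) = sum ?f UNIV"
    by (simp add: UNIV_option_conv sum.reindex homogenize_def)
  then show ?thesis
    using x sum_positive_or_balanced_iff[of UNIV ?f] f n
    by (simp add: closed_halfspace_def sat_def)
qed

text \<open>Segments are cut out by halfspaces, so a vector lies over the segment of
  \<open>x\<close> and \<open>y\<close> once every inequality shared by them passes to it;
  \<open>sat_lsum\<close> and \<open>sat_elim\<close> provide this. The entry at \<open>None\<close>
  has to stay positive for the vector to represent a point.\<close>

lemma tc_cone_over_TC_convex:
  fixes S :: "(symtrop ^ 'd::finite) set"
  assumes S: "TC_convex S"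
  shows "tc_cone {c. signed_vec c \<and> (\<exists>r. c None = TPos r) \<and> dehomogenize c \<in> S}" (is "tc_cone ?C")
proof -
  have closed: "c \<in> ?C"
    if x: "x \<in> ?C" and y: "y \<in> ?C" and c: "signed_vec c" "c None = TPos r"
      and sat: "\<And>b. sat b x (-\<infinity>) \<Longrightarrow> sat b y (-\<infinity>) \<Longrightarrow> sat b c (-\<infinity>)" for x y c r
  proof -
    have dh: "sat b (homogenize (dehomogenize u)) (-\<infinity>) \<longleftrightarrow> sat b u (-\<infinity>)"
      if "u None = TPos m" for b and u :: "'d option \<Rightarrow> symtrop" and m
      using sat_scale[of b "- m" u "-\<infinity>"] homogenize_dehomogenize[of u m] that by simp
    have sg: "dehomogenize u \<in> signed_space" if "signed_vec u" "u None = TPos m"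
      for u :: "'d option \<Rightarrow> symtrop" and m
      using signed_vec_scale[OF that(1)] homogenize_dehomogenize[of u m] that(2)
        signed_vec_homogenize by metis
    obtain m m' where xy: "signed_vec x" "x None = TPos m" "signed_vec y" "y None = TPos m'"
      using x y by auto
    have "dehomogenize c \<in> H" if H: "H \<in> closed_halfspaces" "{dehomogenize x, dehomogenize y} \<subseteq> H" for H
    proof -
      obtain a0 a where a: "H = closed_halfspace a0 a" "a0 \<in> signed_trop" "a \<in> signed_space"
        using H(1) by (auto simp: closed_halfspaces_def)
      show ?thesis
        using H(2) sat unfolding a(1)
        by (simp add: closed_halfspace_iff sg[OF c] sg[OF xy(1,2)] sg[OF xy(3,4)] a dh[where u = c, OF c(2)]
            dh[where u = x, OF xy(2)] dh[where u = y, OF xy(4)])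
    qed
    then have "dehomogenize c \<in> TC_segment (dehomogenize x) (dehomogenize y)"
      using sg[OF c] by (simp add: TC_segment_def halfspace_hull_def)
    then have "dehomogenize c \<in> S"
      using S x y unfolding TC_convex_def by blast
    with c show ?thesis
      by blast
  qed
  have 1: "scale r x \<in> ?C" if x: "x \<in> ?C" for x r
  proof -
    obtain r' where "x None = TPos r'"
      using x by blast
    then show ?thesis
      using x dehomogenize_scale[of x r' r] signed_vec_scale[of x r] by (simp add: scale_def)
  qed
  have 2: "lsum x y \<in> ?C" if xy: "x \<in> ?C" "y \<in> ?C" for x y
  proof -
    obtain m m' where N: "signed_vec x" "signed_vec y" "x None = TPos m" "y None = TPos m'"
      using xy by auto
    show ?thesis
    proof (rule closed[OF xy])
      show "signed_vec (lsum x y)"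
        by (intro signed_vec_lsum N)
      show "lsum x y None = TPos (max m m')"
        using N by (simp add: lsum_def left_sum_def)
      show "sat b (lsum x y) (-\<infinity>)" if "sat b x (-\<infinity>)" "sat b y (-\<infinity>)" for b
        using sat_lsum[OF that(1) N(1) that(2) N(2)] .
    qed
  qed
  have 3: "(lsum x y)(v := TZero) \<in> ?C"
    if xy: "x \<in> ?C" "y \<in> ?C" and v: "opposite (x v) (y v)" "\<And>i. i \<noteq> v \<Longrightarrow> \<not> opposite (x i) (y i)" for x y v
  proof -
    obtain m m' where N: "signed_vec x" "signed_vec y" "x None = TPos m" "y None = TPos m'"
      using xy by auto
    let ?f = "(lsum x y)(v := TZero)"
    \<comment> \<open>Both entries at \<open>None\<close> are positive, so the homogenizing
      coordinate is never the one eliminated.\<close>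
    have "v \<noteq> None"
      using N v(1) by (cases v) (simp_all add: opposite_def)
    show ?thesis
    proof (rule closed[OF xy])
      show "signed_vec ?f"
        by (intro signed_vec_upd signed_vec_lsum N) (simp add: signed_trop_iff)
      show "?f None = TPos (max m m')"
        using N \<open>v \<noteq> None\<close> by (auto simp: lsum_def left_sum_def)
      show "sat b ?f (-\<infinity>)" if "sat b x (-\<infinity>)" "sat b y (-\<infinity>)" for b
        using sat_elim[OF that(1) N(1) that(2) N(2) v] .
    qed
  qed
  show ?thesis
    unfolding tc_cone_def using 1 2 3 by (intro conjI) blast+
qed

section \<open>Separation of points from TC-convex sets by closed halfspaces\<close>

lemma TC_convex_halfspace_hull: "TC_convex (halfspace_hull M)"
  unfolding TC_convex_def TC_segment_def halfspace_hull_def by auto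

text \<open>Serves the case of the empty set, whose hull is empty. The signs of \<open>a\<close> are
  chosen so that every nonzero term at \<open>z\<close> is negative, and the constant term
  \<open>TNeg 0\<close> keeps the sum from vanishing.\<close>

lemma closed_halfspace_avoiding_point:
  fixes z :: "symtrop ^ 'd::finite"
  assumes z: "z \<in> signed_space"
  obtains H where "H \<in> closed_halfspaces" "z \<notin> H"
proof -
  define a where "a = (\<chi> i. case z $ i of TPos r \<Rightarrow> TNeg 0 | _ \<Rightarrow> TPos 0)"
  have a: "a \<in> signed_space" "a \<noteq> 0"
    by (auto simp: a_def signed_space_def signed_trop_iff vec_eq_iff zero_symtrop_def split: symtrop.splits)
  have "halfspace_normal (TNeg 0) a j * homogenize z j \<noteq> TNeg n" for j n
    by (cases j; cases "z $ (the j)") (auto simp: halfspace_normal_def homogenize_def a_def)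
  moreover have "halfspace_normal (TNeg 0) a None * homogenize z None = TPos 0"
    by (simp add: halfspace_normal_def homogenize_def)
  ultimately have "\<not> sat (halfspace_normal (TNeg 0) a) (homogenize z) (-\<infinity>)"
    using sat_minf[of "halfspace_normal (TNeg 0) a" "homogenize z" None 0] by blast
  then have "z \<notin> closed_halfspace (TNeg 0) a"
    using closed_halfspace_iff[OF z _ a(1), of "TNeg 0"] by (simp add: signed_trop_iff)
  moreover have "closed_halfspace (TNeg 0) a \<in> closed_halfspaces"
    using a by (auto simp: closed_halfspaces_def signed_trop_iff)
  ultimately show ?thesis
    using that by blast
qed

lemma TC_convex_separation:
  fixes S :: "(symtrop ^ 'd::finite) set"
  assumes S: "TC_convex S" and X: "finite X" "X \<subseteq> S" and z: "z \<in> signed_space" "z \<notin> S"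
  obtains H where "H \<in> closed_halfspaces" "X \<subseteq> H" "z \<notin> H"
proof (cases "X = {}")
  case True
  then show ?thesis
    using that closed_halfspace_avoiding_point[OF z(1)] by blast
next
  case False
  have XS: "X \<subseteq> signed_space"
    using S X by (auto simp: TC_convex_def)
  let ?C = "{c. signed_vec c \<and> (\<exists>r. c None = TPos r) \<and> dehomogenize c \<in> S}"
  have "homogenize ` X \<subseteq> ?C"
    using X XS by (auto simp: signed_vec_homogenize) (auto simp: homogenize_def)
  moreover have "homogenize z \<notin> ?C"
    using z by simp
  moreover have "homogenize z None \<noteq> TZero"
    by (simp add: homogenize_def)
  ultimately obtain b where b: "signed_vec b" "\<forall>x\<in>homogenize ` X. sat b x (-\<infinity>)" "\<not> sat b (homogenize z) (-\<infinity>)"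
    using tc_cone_separation[OF tc_cone_over_TC_convex[OF S], of "homogenize ` X" "homogenize z" None]
      X z(1) signed_vec_homogenize[of z] by blast
  define a0 where "a0 = TNeg 0 * b None"
  define a where "a = (\<chi> i. TNeg 0 * b (Some i))"
  have neg_neg: "TNeg 0 * (TNeg 0 * c) = c" if "c \<in> signed_trop" for c
    using that by (cases c) (auto simp: signed_trop_iff)
  have n: "halfspace_normal a0 a = b"
  proof
    fix j show "halfspace_normal a0 a j = b j"
      using b(1) neg_neg by (cases j) (simp_all add: halfspace_normal_def a0_def a_def signed_vec_def)
  qed
  have sg: "a0 \<in> signed_trop" "a \<in> signed_space"
    using b(1) by (auto simp: a0_def a_def signed_space_def signed_vec_def intro!: times_signed)
      (simp_all add: signed_trop_iff)
  \<comment> \<open>A normal supported on \<open>None\<close> imposes the same condition at every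
    point, so it could not hold on the nonempty \<open>X\<close> and fail at
    \<open>z\<close>.\<close>
  have "a \<noteq> 0"
  proof
    assume "a = 0"
    then have "b (Some i) = TZero" for i
      using n by (auto simp: halfspace_normal_def zero_symtrop_def dest: fun_cong[of _ _ "Some i"])
    then have "b j * homogenize x j = b j * homogenize y j" for j and x y :: "symtrop ^ 'd"
      by (cases j) (simp_all add: homogenize_def)
    then have "sat b (homogenize x) t \<longleftrightarrow> sat b (homogenize y) t" for x y :: "symtrop ^ 'd" and t
      by (rule sat_cong)
    with b(2,3) False show False
      by blast
  qed
  then have "closed_halfspace a0 a \<in> closed_halfspaces"
    using sg by (auto simp: closed_halfspaces_def)
  moreover have "X \<subseteq> closed_halfspace a0 a"
    using b(2) XS closed_halfspace_iff[OF _ sg] n by auto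
  moreover have "z \<notin> closed_halfspace a0 a"
    using b(3) closed_halfspace_iff[OF z(1) sg] n by simp
  ultimately show ?thesis
    using that by blast
qed

theorem theorem6p3:
  fixes X :: "(symtrop ^ 'd::finite) set"
  assumes "finite X" and "X \<subseteq> signed_space"
  shows "TC_hull X = signed_space \<inter> \<Inter>{H \<in> closed_halfspaces. X \<subseteq> H}"
proof
  have "X \<subseteq> halfspace_hull X"
    using assms(2) by (auto simp: halfspace_hull_def)
  then have "TC_hull X \<subseteq> halfspace_hull X"
    unfolding TC_hull_def using TC_convex_halfspace_hull by blast
  then show "TC_hull X \<subseteq> signed_space \<inter> \<Inter>{H \<in> closed_halfspaces. X \<subseteq> H}"
    by (simp add: halfspace_hull_def)
next
  show "signed_space \<inter> \<Inter>{H \<in> closed_halfspaces. X \<subseteq> H} \<subseteq> TC_hull X"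
  proof
    fix z assume z: "z \<in> signed_space \<inter> \<Inter>{H \<in> closed_halfspaces. X \<subseteq> H}"
    have "z \<in> S" if S: "TC_convex S" "X \<subseteq> S" for S
    proof (rule ccontr)
      assume "z \<notin> S"
      then obtain H where "H \<in> closed_halfspaces" "X \<subseteq> H" "z \<notin> H"
        using TC_convex_separation[OF S(1) assms(1) S(2)] z by blast
      with z show False
        by blast
    qed
    then show "z \<in> TC_hull X"
      by (simp add: TC_hull_def)
  qed
qed

end
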